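(* For every integer $n\ge 1$, the number of (isomorphism classes of) rooted bridgeless combinatorial maps of size $n$ is equal to the number of (isomorphism classes of) rooted connected chord diagrams of size $n$.
   Context: A rooted chord diagram of size $n$ is (up to isomorphism) a perfect matching of the linearly ordered set $\{0<1<\dots<2n-1\}$ into $n$ pairs $(a,b)$ with $a<b$, called chords; the root chord is the chord containing $0$. Two chords $(a,b)$ and $(c,d)$ cross if $a<c<b<d$ or $c<a<d<b$. A diagram is connected if the graph whose vertices are the chords and whose edges join crossing chords is connected. A rooted combinatorial map is a quadruple $(H,\sigma,\alpha,r)$ where $H$ is a finite set of half-edges, $\sigma$ is a permutation of $H$, $\alpha$ is an involution of $H$, $r\in H$ satisfies $\alpha(r)=r$, and the group generated by $\sigma,\alpha$ acts transitively on $H$; isomorphisms are bijections commuting with $\sigma,\alpha$ and preserving $r$. Here maps are closed: $r$ is the only fixed point of $\alpha$. The underlying graph has the $\sigma$-orbits as vertices and the $\alpha$-orbits as edges (the orbit $\{r\}$ is a dangling edge, the root), an edge being incident to the vertices it meets. The size of a map is the number of $\alpha$-orbits (the root counts as an edge), so the map with a single half-edge has size $1$. A map is bridgeless if its underlying graph has no edge whose deletion disconnects it. *)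

theory Defs
  imports Main
begin

section \<open>Rooted chord diagrams\<close>

text \<open>A rooted chord diagram of size n: a perfect matching of {0,...,2n-1} into
  chords (a,b) with a < b. Since the ground set is linearly ordered and isomorphisms
  must preserve the order, isomorphism classes coincide with the matchings themselves.\<close>

definition chord_diagram :: "nat \<Rightarrow> (nat \<times> nat) set \<Rightarrow> bool" where
  "chord_diagram n C \<longleftrightarrow>
     C \<subseteq> {(a, b). a < b \<and> b < 2 * n} \<and>
     (\<forall>x < 2 * n. \<exists>!p. p \<in> C \<and> (x = fst p \<or> x = snd p))"

definition crosses :: "nat \<times> nat \<Rightarrow> nat \<times> nat \<Rightarrow> bool" where
  "crosses p q \<longleftrightarrow>
     (fst p < fst q \<and> fst q < snd p \<and> snd p < snd q) \<or>
     (fst q < fst p \<and> fst p < snd q \<and> snd q < snd p)"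

text \<open>Connected: the crossing graph on the chords is connected.\<close>
definition connected_diagram :: "(nat \<times> nat) set \<Rightarrow> bool" where
  "connected_diagram C \<longleftrightarrow>
     (\<forall>c \<in> C. \<forall>d \<in> C. (c, d) \<in> {(p, q). p \<in> C \<and> q \<in> C \<and> crosses p q}\<^sup>*)"

definition connected_chord_diagrams :: "nat \<Rightarrow> (nat \<times> nat) set set" where
  "connected_chord_diagrams n = {C. chord_diagram n C \<and> connected_diagram C}"

section \<open>Rooted closed combinatorial maps\<close>

text \<open>A map is represented as (m, sigma, alpha, r) with half-edge set H = {0..<m};
  sigma and alpha are permutations of H (extended by the identity outside H).
  Every finite map is isomorphic to one of this form.\<close>

type_synonym cmap = "nat \<times> (nat \<Rightarrow> nat) \<times> (nat \<Rightarrow> nat) \<times> nat"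

definition orbit :: "(nat \<Rightarrow> nat) \<Rightarrow> nat \<Rightarrow> nat set" where
  "orbit f h = {(f ^^ k) h | k. True}"

definition is_closed_rooted_map :: "cmap \<Rightarrow> bool" where
  "is_closed_rooted_map M \<longleftrightarrow>
     (case M of (m, \<sigma>, \<alpha>, r) \<Rightarrow>
        bij_betw \<sigma> {0..<m} {0..<m} \<and> (\<forall>h. h \<ge> m \<longrightarrow> \<sigma> h = h) \<and>
        bij_betw \<alpha> {0..<m} {0..<m} \<and> (\<forall>h. h \<ge> m \<longrightarrow> \<alpha> h = h) \<and>
        (\<forall>h < m. \<alpha> (\<alpha> h) = h) \<and>
        r < m \<and> \<alpha> r = r \<and> (\<forall>h < m. \<alpha> h = h \<longrightarrow> h = r) \<and>
        \<comment> \<open>transitivity of the group generated by sigma, alpha (finite case: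
            reachability by forward steps equals the group orbit)\<close>
        (\<forall>h < m. (r, h) \<in> {(x, y). x < m \<and> (y = \<sigma> x \<or> y = \<alpha> x)}\<^sup>*))"

definition map_size :: "cmap \<Rightarrow> nat" where
  "map_size M = (case M of (m, \<sigma>, \<alpha>, r) \<Rightarrow> card {orbit \<alpha> h | h. h < m})"

text \<open>Underlying graph: vertices are sigma-orbits, edges are alpha-orbits, an edge
  being incident to the vertices it meets.\<close>

definition map_vertices :: "cmap \<Rightarrow> nat set set" where
  "map_vertices M = (case M of (m, \<sigma>, \<alpha>, r) \<Rightarrow> {orbit \<sigma> h | h. h < m})"

definition map_edges :: "cmap \<Rightarrow> nat set set" where
  "map_edges M = (case M of (m, \<sigma>, \<alpha>, r) \<Rightarrow> {orbit \<alpha> h | h. h < m})"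

text \<open>Adjacency of vertices in the underlying graph with the edge e deleted.\<close>
definition adj_without :: "cmap \<Rightarrow> nat set \<Rightarrow> (nat set \<times> nat set) set" where
  "adj_without M e = {(v, w). v \<in> map_vertices M \<and> w \<in> map_vertices M \<and>
      (\<exists>e' \<in> map_edges M - {e}. v \<inter> e' \<noteq> {} \<and> w \<inter> e' \<noteq> {})}"

definition is_bridge :: "cmap \<Rightarrow> nat set \<Rightarrow> bool" where
  "is_bridge M e \<longleftrightarrow> e \<in> map_edges M \<and>
     \<not> (\<forall>v \<in> map_vertices M. \<forall>w \<in> map_vertices M. (v, w) \<in> (adj_without M e)\<^sup>*)"

definition bridgeless :: "cmap \<Rightarrow> bool" where
  "bridgeless M \<longleftrightarrow> (\<forall>e. \<not> is_bridge M e)"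

definition map_iso :: "cmap \<Rightarrow> cmap \<Rightarrow> bool" where
  "map_iso M M' \<longleftrightarrow>
     (case M of (m, \<sigma>, \<alpha>, r) \<Rightarrow> case M' of (m', \<sigma>', \<alpha>', r') \<Rightarrow>
        (\<exists>\<phi>. bij_betw \<phi> {0..<m} {0..<m'} \<and>
             (\<forall>h < m. \<phi> (\<sigma> h) = \<sigma>' (\<phi> h) \<and> \<phi> (\<alpha> h) = \<alpha>' (\<phi> h)) \<and> \<phi> r = r'))"

definition bridgeless_maps :: "nat \<Rightarrow> cmap set" where
  "bridgeless_maps n = {M. is_closed_rooted_map M \<and> map_size M = n \<and> bridgeless M}"

text \<open>Number of isomorphism classes of rooted bridgeless closed maps of size n.\<close>
definition num_bridgeless_maps :: "nat \<Rightarrow> nat" where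
  "num_bridgeless_maps n =
     card (bridgeless_maps n // {(M, M'). M \<in> bridgeless_maps n \<and> M' \<in> bridgeless_maps n \<and> map_iso M M'})"

end

theory Submission
  imports Defs "HOL-Combinatorics.Permutations" "HOL-Library.Infinite_Set"
begin

text \<open>
  Both sequences satisfy \<open>a\<^sub>1 = 1\<close> and \<open>a\<^sub>n = (\<Sum>k=1..n-1. (2k-1) a\<^sub>k a\<^bsub>n-k\<^esub>)\<close>.

  For diagrams, remove the root chord of a connected diagram and let \<open>X\<close> be the component of the
  chord at the point 1. The other components all cross the root chord but not \<open>X\<close>, so apart from
  the point 0 everything outside \<open>X\<close> lies in a single one of the \<open>2k-1\<close> inner gaps of \<open>X\<close>.

  For maps, let \<open>x = \<sigma> r\<close>. Deleting the edge \<open>{x, \<alpha> x}\<close> of a bridgeless map leaves a chain of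
  bridgeless maps joined by bridges, running from the root to \<open>\<alpha> x\<close>. Cut the first bridge
  \<open>{u, v}\<close>: the part of the root is a bridgeless map with a marked corner (where \<open>u\<close> was attached,
  \<open>2k-1\<close> choices), and the other part, rooted at \<open>v\<close> and with \<open>x\<close> moved next to \<open>v\<close>, is bridgeless
  too. On a fixed set of half-edges this is a bijection on the nose. Since rooted maps have no
  automorphisms, each isomorphism class of maps of size \<open>n\<close> has \<open>(2n-1)!\<close> labellings, and the
  binomial coefficients that distribute the labels cancel.
\<close>

section \<open>Rooted maps\<close>

type_synonym 'a rmap = "('a \<Rightarrow> 'a) \<times> ('a \<Rightarrow> 'a) \<times> 'a"

definition invariant :: "('a \<Rightarrow> 'a) \<Rightarrow> 'a set \<Rightarrow> bool" where
  "invariant f T \<longleftrightarrow> (\<forall>h. f h \<in> T \<longleftrightarrow> h \<in> T)"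

definition exits :: "('a \<Rightarrow> 'a) \<Rightarrow> 'a set \<Rightarrow> 'a set" where
  "exits \<alpha> T = {h \<in> T. \<alpha> h \<notin> T}"

lemma invariantD: "invariant f T \<Longrightarrow> f h \<in> T \<longleftrightarrow> h \<in> T"
  by (simp add: invariant_def)

lemma finite_invariantI:
  assumes "finite T" "inj f" "\<And>h. h \<in> T \<Longrightarrow> f h \<in> T"
  shows "invariant f T"
proof -
  have "f ` T = T" using assms by (intro endo_inj_surj) (auto intro: inj_on_subset)
  then show ?thesis using assms(2) by (metis inj_image_mem_iff invariant_def)
qed

lemma permutes_Un_restrict_id:
  assumes f: "f permutes A \<union> B" and disjoint: "A \<inter> B = {}" and A: "invariant f A"
  shows "restrict_id f A permutes A" "restrict_id f B permutes B"
    and "restrict_id f A \<circ> restrict_id f B = f"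
proof -
  have B: "invariant f B"
    using permutes_in_image[OF f] invariantD[OF A] disjoint unfolding invariant_def by blast
  have "bij_betw f C C" if "invariant f C" for C
  proof (rule bij_betw_imageI)
    show "inj_on f C" using permutes_inj[OF f] by (rule inj_on_subset) simp
    show "f ` C = C"
      using invariantD[OF that] permutes_surj[OF f] by (auto simp: image_iff) (metis surjD)
  qed
  then show "restrict_id f A permutes A" "restrict_id f B permutes B"
    using A B by (auto intro: permutes_restrict_id)
  show "restrict_id f A \<circ> restrict_id f B = f"
  proof
    fix h
    consider "h \<in> A" | "h \<in> B" | "h \<notin> A \<union> B" by blast
    then show "(restrict_id f A \<circ> restrict_id f B) h = f h"
      using disjoint invariantD[OF B, of h] permutes_not_in[OF f, of h]
      by cases (auto simp: restrict_id_def)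
  qed
qed

locale rooted_map =
  fixes H :: "'a set" and \<sigma> \<alpha> :: "'a \<Rightarrow> 'a" and r :: 'a
  assumes finite_H: "finite H"
    and \<sigma>_permutes: "\<sigma> permutes H"
    and \<alpha>_permutes: "\<alpha> permutes H"
    and \<alpha>_\<alpha> [simp]: "\<alpha> (\<alpha> h) = h"
    and root_in [simp]: "r \<in> H"
    and \<alpha>_fixed_iff: "h \<in> H \<Longrightarrow> \<alpha> h = h \<longleftrightarrow> h = r"
begin

lemma \<sigma>_in_iff [simp]: "\<sigma> h \<in> H \<longleftrightarrow> h \<in> H"
  by (rule permutes_in_image[OF \<sigma>_permutes])

lemma \<alpha>_in_iff [simp]: "\<alpha> h \<in> H \<longleftrightarrow> h \<in> H"
  by (rule permutes_in_image[OF \<alpha>_permutes])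

lemma \<sigma>_eq_iff [simp]: "\<sigma> g = \<sigma> h \<longleftrightarrow> g = h"
  using permutes_inj[OF \<sigma>_permutes] by (rule inj_eq)

lemma \<alpha>_eq_iff [simp]: "\<alpha> g = \<alpha> h \<longleftrightarrow> g = h"
  using permutes_inj[OF \<alpha>_permutes] by (rule inj_eq)

lemma \<alpha>_root [simp]: "\<alpha> r = r"
  by (simp add: \<alpha>_fixed_iff)

lemma \<alpha>_eq_root_iff [simp]: "\<alpha> h = r \<longleftrightarrow> h = r" "r = \<alpha> h \<longleftrightarrow> h = r"
  using \<alpha>_eq_iff[of h r] by auto

lemma \<sigma>_outside: "h \<notin> H \<Longrightarrow> \<sigma> h = h"
  by (rule permutes_not_in[OF \<sigma>_permutes])

lemma \<alpha>_outside: "h \<notin> H \<Longrightarrow> \<alpha> h = h"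
  by (rule permutes_not_in[OF \<alpha>_permutes])

lemma invariant_\<sigma>I: "T \<subseteq> H \<Longrightarrow> (\<And>h. h \<in> T \<Longrightarrow> \<sigma> h \<in> T) \<Longrightarrow> invariant \<sigma> T"
  using finite_H \<sigma>_permutes by (auto intro: finite_invariantI finite_subset permutes_inj)

lemma card_H: "card H + 1 = 2 * card ((\<lambda>h. {h, \<alpha> h}) ` H)"
proof -
  let ?E = "(\<lambda>h. {h, \<alpha> h}) ` (H - {r})"
  have Union_E: "\<Union> ?E = H - {r}" by auto
  have "2 * card ?E = card (\<Union> ?E)"
  proof (rule card_partition)
    show "card e = 2" if e: "e \<in> ?E" for e
    proof -
      obtain h where "h \<in> H - {r}" "e = {h, \<alpha> h}" using e by blast
      then show ?thesis using \<alpha>_fixed_iff[of h] by auto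
    qed
    show "e \<inter> e' = {}" if "e \<in> ?E" "e' \<in> ?E" "e \<noteq> e'" for e e'
    proof -
      have "c = {h, \<alpha> h}" if "c \<in> ?E" "h \<in> c" for c h using that by auto
      then show ?thesis using that by blast
    qed
  qed (use finite_H Union_E in auto)
  then have "2 * card ?E = card H - 1" using Union_E finite_H by simp
  moreover have "card ((\<lambda>h. {h, \<alpha> h}) ` H) = card ?E + 1"
  proof -
    have "(\<lambda>h. {h, \<alpha> h}) ` insert r (H - {r}) = insert {r} ?E"
      by (simp only: image_insert \<alpha>_root insert_absorb2)
    then have "(\<lambda>h. {h, \<alpha> h}) ` H = insert {r} ?E" by (simp only: insert_Diff[OF root_in])
    moreover have "{r} \<notin> ?E" by auto
    ultimately show ?thesis using finite_H by simp
  qed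
  moreover have "H \<noteq> {}" using root_in by blast
  then have "card H > 0" using finite_H by (simp add: card_gt_0_iff)
  ultimately show ?thesis by simp
qed

lemma odd_card_H: "odd (card H)"
  using card_H by presburger

end

text \<open>An invariant set of half-edges is a union of vertices, and its exits are the half-edges
  leading to other vertices. The cut condition thus expresses connectedness (no exit) and
  bridgelessness (one exit) at once.\<close>

locale bridgeless_map = rooted_map +
  assumes cut_condition:
    "T \<subseteq> H \<Longrightarrow> r \<notin> T \<Longrightarrow> invariant \<sigma> T \<Longrightarrow> exits \<alpha> T \<subseteq> {a} \<Longrightarrow> T = {}"

definition bridgeless_maps_on :: "'a set \<Rightarrow> 'a rmap set" where
  "bridgeless_maps_on H = {(\<sigma>, \<alpha>, r). bridgeless_map H \<sigma> \<alpha> r}"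

lemma mem_bridgeless_maps_on [simp]:
  "(\<sigma>, \<alpha>, r) \<in> bridgeless_maps_on H \<longleftrightarrow> bridgeless_map H \<sigma> \<alpha> r"
  by (simp add: bridgeless_maps_on_def)

lemma finite_bridgeless_maps_on:
  assumes "finite H"
  shows "finite (bridgeless_maps_on H)"
proof (rule finite_subset)
  show "bridgeless_maps_on H \<subseteq> {\<sigma>. \<sigma> permutes H} \<times> {\<alpha>. \<alpha> permutes H} \<times> H"
    by (auto simp: bridgeless_map_def rooted_map_def)
qed (use assms finite_permutations in auto)

lemma bridgeless_maps_on_even:
  assumes "even (card H)"
  shows "bridgeless_maps_on H = {}"
  using assms rooted_map.odd_card_H by (fastforce simp: bridgeless_map_def)

lemma bridgeless_maps_on_singleton: "bridgeless_maps_on {h :: 'a} = {(id, id, h)}"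
proof (intro equalityI subsetI)
  fix M :: "'a rmap" assume "M \<in> bridgeless_maps_on {h}"
  then show "M \<in> {(id, id, h)}"
    by (auto simp: bridgeless_maps_on_def bridgeless_map_def rooted_map_def)
next
  fix M :: "'a rmap" assume "M \<in> {(id, id, h)}"
  moreover have "bridgeless_map {h} id id h" by unfold_locales auto
  ultimately show "M \<in> bridgeless_maps_on {h}" by simp
qed

section \<open>Relabelling\<close>

definition relabel :: "'a set \<Rightarrow> ('a \<Rightarrow> 'b) \<Rightarrow> 'a rmap \<Rightarrow> 'b rmap" where
  "relabel H \<phi> = (\<lambda>(\<sigma>, \<alpha>, r). (map_permutation H \<phi> \<sigma>, map_permutation H \<phi> \<alpha>, \<phi> r))"

lemma bridgeless_map_relabel:
  assumes "bridgeless_map H \<sigma> \<alpha> r" and bij: "bij_betw \<phi> H H'"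
  shows "bridgeless_map H' (map_permutation H \<phi> \<sigma>) (map_permutation H \<phi> \<alpha>) (\<phi> r)"
    (is "bridgeless_map H' ?\<sigma> ?\<alpha> _")
proof -
  interpret bridgeless_map H \<sigma> \<alpha> r by fact
  have inj: "inj_on \<phi> H" and H': "H' = \<phi> ` H" using bij by (auto simp: bij_betw_def)
  have \<sigma>: "?\<sigma> permutes H'" and \<alpha>: "?\<alpha> permutes H'"
    using bij \<sigma>_permutes \<alpha>_permutes by (auto intro: map_permutation_permutes)
  note [simp] = map_permutation_apply[OF inj] inj_on_eq_iff[OF inj]
  show ?thesis
  proof unfold_locales
    show "finite H'" using finite_H H' by simp
    show "?\<alpha> (?\<alpha> h') = h'" for h'
      by (cases "h' \<in> H'") (auto simp: H' permutes_not_in[OF \<alpha>])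
    show "?\<alpha> h' = h' \<longleftrightarrow> h' = \<phi> r" if "h' \<in> H'" for h'
      using that \<alpha>_fixed_iff by (auto simp: H')
  next
    fix T' a assume T': "T' \<subseteq> H'" "\<phi> r \<notin> T'" "invariant ?\<sigma> T'" "exits ?\<alpha> T' \<subseteq> {a}"
    let ?T = "{h \<in> H. \<phi> h \<in> T'}"
    have "?T = {}"
    proof (rule cut_condition)
      show "invariant \<sigma> ?T"
      proof (rule invariant_\<sigma>I)
        show "\<sigma> h \<in> ?T" if "h \<in> ?T" for h
          using that invariantD[OF T'(3), of "\<phi> h"] by simp
      qed auto
      show "exits \<alpha> ?T \<subseteq> {inv_into H \<phi> a}"
      proof
        fix h assume "h \<in> exits \<alpha> ?T"
        then have "\<phi> h \<in> exits ?\<alpha> T'" "h \<in> H" by (auto simp: exits_def)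
        then show "h \<in> {inv_into H \<phi> a}" using T'(4) inv_into_f_f[OF inj, of h] by auto
      qed
    qed (use T'(2) in auto)
    then show "T' = {}" using T'(1) by (auto simp: H')
  qed (use \<sigma> \<alpha> H' in auto)
qed

lemma relabel_in_bridgeless_maps_on:
  assumes "M \<in> bridgeless_maps_on H" "bij_betw \<phi> H H'"
  shows "relabel H \<phi> M \<in> bridgeless_maps_on H'"
  using assms by (cases M) (simp add: relabel_def bridgeless_map_relabel)

lemma relabel_compose:
  assumes "bij_betw \<phi> H H'" "inj_on \<psi> H'"
  shows "relabel H' \<psi> (relabel H \<phi> M) = relabel H (\<psi> \<circ> \<phi>) M"
  using assms by (cases M) (simp add: relabel_def map_permutation_compose)

lemma relabel_inverse:
  assumes "M \<in> bridgeless_maps_on H" "bij_betw \<phi> H H'" "\<And>h. h \<in> H \<Longrightarrow> \<psi> (\<phi> h) = h"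
  shows "relabel H' \<psi> (relabel H \<phi> M) = M"
  using assms
  by (cases M) (auto simp: relabel_def bridgeless_map_def rooted_map_def
      intro: map_permutation_compose_inv)

lemma relabel_eq_iff:
  assumes "(\<sigma>', \<alpha>', r') \<in> bridgeless_maps_on H'" and bij: "bij_betw \<phi> H H'"
  shows "relabel H \<phi> (\<sigma>, \<alpha>, r) = (\<sigma>', \<alpha>', r') \<longleftrightarrow>
    (\<forall>h\<in>H. \<phi> (\<sigma> h) = \<sigma>' (\<phi> h) \<and> \<phi> (\<alpha> h) = \<alpha>' (\<phi> h)) \<and> \<phi> r = r'"
proof -
  have "map_permutation H \<phi> f = g \<longleftrightarrow> (\<forall>h\<in>H. \<phi> (f h) = g (\<phi> h))" if "g permutes H'" for f g
    using bij permutes_not_in[OF that]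
    by (auto simp: bij_betw_def map_permutation_apply map_permutation_def restrict_id_def
        fun_eq_iff)
  then show ?thesis
    using assms(1) by (auto simp: relabel_def bridgeless_map_def rooted_map_def)
qed

lemma relabel_rigid:
  assumes M: "M \<in> bridgeless_maps_on H" and bij: "bij_betw \<phi> H H'" "bij_betw \<psi> H H'"
    and eq: "relabel H \<phi> M = relabel H \<psi> M" and "h \<in> H"
  shows "\<phi> h = \<psi> h"
proof -
  obtain \<sigma> \<alpha> r where M_eq: "M = (\<sigma>, \<alpha>, r)" by (cases M)
  interpret bridgeless_map H \<sigma> \<alpha> r using M M_eq by simp
  obtain \<sigma>' \<alpha>' r' where M': "relabel H \<phi> M = (\<sigma>', \<alpha>', r')" by (cases "relabel H \<phi> M")
  interpret M': bridgeless_map H' \<sigma>' \<alpha>' r'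
    using relabel_in_bridgeless_maps_on[OF M bij(1)] M' by simp
  have isom: "(\<forall>h\<in>H. \<chi> (\<sigma> h) = \<sigma>' (\<chi> h) \<and> \<chi> (\<alpha> h) = \<alpha>' (\<chi> h)) \<and> \<chi> r = r'"
    if "bij_betw \<chi> H H'" "relabel H \<chi> M = (\<sigma>', \<alpha>', r')" for \<chi>
    using relabel_eq_iff[of \<sigma>' \<alpha>' r' H' \<chi> H] that M_eq M'.bridgeless_map_axioms by simp
  note \<phi> = isom[OF bij(1) M'] and \<psi> = isom[OF bij(2) M'[unfolded eq]]
  let ?T = "{h \<in> H. \<phi> h \<noteq> \<psi> h}"
  have "?T = {}"
  proof (rule cut_condition)
    show "invariant \<sigma> ?T" by (rule invariant_\<sigma>I) (auto simp: \<phi> \<psi>)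
    show "exits \<alpha> ?T \<subseteq> {r}" by (auto simp: exits_def \<phi> \<psi>)
  qed (use \<phi> \<psi> in auto)
  then show ?thesis using \<open>h \<in> H\<close> by blast
qed

lemma bij_betw_relabel:
  assumes "bij_betw \<phi> H H'"
  shows "bij_betw (relabel H \<phi>) (bridgeless_maps_on H) (bridgeless_maps_on H')"
proof (rule bij_betw_byWitness[where f' = "relabel H' (inv_into H \<phi>)"])
  have inv: "bij_betw (inv_into H \<phi>) H' H" using assms by (rule bij_betw_inv_into)
  show "\<forall>M\<in>bridgeless_maps_on H. relabel H' (inv_into H \<phi>) (relabel H \<phi> M) = M"
    using assms by (auto intro!: relabel_inverse simp: bij_betw_inv_into_left)
  show "\<forall>M\<in>bridgeless_maps_on H'. relabel H \<phi> (relabel H' (inv_into H \<phi>) M) = M"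
    using assms inv by (auto intro!: relabel_inverse simp: bij_betw_inv_into_right)
  show "relabel H \<phi> ` bridgeless_maps_on H \<subseteq> bridgeless_maps_on H'"
    "relabel H' (inv_into H \<phi>) ` bridgeless_maps_on H' \<subseteq> bridgeless_maps_on H"
    using assms inv relabel_in_bridgeless_maps_on by blast+
qed

lemma card_bridgeless_maps_on_cong:
  assumes "finite A" "finite B" "card A = card B"
  shows "card (bridgeless_maps_on A) = card (bridgeless_maps_on B)"
proof -
  obtain \<phi> where "bij_betw \<phi> A B" using assms bij_betw_iff_card by blast
  then show ?thesis by (rule bij_betw_same_card[OF bij_betw_relabel])
qed

lemma card_relabellings:
  assumes "M \<in> bridgeless_maps_on H" "finite H"
  shows "card ((\<lambda>\<phi>. relabel H \<phi> M) ` {\<phi>. \<phi> permutes H}) = fact (card H)"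
proof -
  have "inj_on (\<lambda>\<phi>. relabel H \<phi> M) {\<phi>. \<phi> permutes H}"
  proof (rule inj_onI)
    fix \<phi> \<psi> assume "\<phi> \<in> {\<phi>. \<phi> permutes H}" "\<psi> \<in> {\<phi>. \<phi> permutes H}"
      and eq: "relabel H \<phi> M = relabel H \<psi> M"
    then have \<phi>: "\<phi> permutes H" and \<psi>: "\<psi> permutes H" by auto
    have "\<phi> h = \<psi> h" for h
      using relabel_rigid[OF assms(1) permutes_imp_bij[OF \<phi>] permutes_imp_bij[OF \<psi>] eq]
        permutes_not_in[OF \<phi>] permutes_not_in[OF \<psi>] by (cases "h \<in> H") auto
    then show "\<phi> = \<psi>" ..
  qed
  then show ?thesis using assms(2) by (simp add: card_image card_permutations)
qed

section \<open>Cuts and bridges\<close>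

lemma orbit_self: "h \<in> orbit f h"
  unfolding orbit_def by (intro CollectI exI[of _ 0]) simp

lemma orbit_step: "k \<in> orbit f h \<Longrightarrow> f k \<in> orbit f h"
  unfolding orbit_def by (auto intro: exI[of _ "Suc _"])

lemma orbit_least:
  assumes "h \<in> T" "\<And>k. k \<in> T \<Longrightarrow> f k \<in> T"
  shows "orbit f h \<subseteq> T"
proof -
  have "(f ^^ n) h \<in> T" for n by (induction n) (use assms in auto)
  then show ?thesis by (auto simp: orbit_def)
qed

lemma orbit_subset_invariant: "invariant f T \<Longrightarrow> h \<in> T \<Longrightarrow> orbit f h \<subseteq> T"
  by (rule orbit_least) (auto simp: invariantD)

lemma orbit_disjoint_invariant: "invariant f T \<Longrightarrow> h \<notin> T \<Longrightarrow> orbit f h \<inter> T = {}"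
  using orbit_least[of h "- T" f] by (auto simp: invariantD)

lemma orbit_involution:
  assumes "f (f h) = h"
  shows "orbit f h = {h, f h}"
proof
  show "orbit f h \<subseteq> {h, f h}" using assms by (intro orbit_least) auto
  show "{h, f h} \<subseteq> orbit f h" by (simp add: orbit_self orbit_step)
qed

lemma is_closed_rooted_map_iff:
  "is_closed_rooted_map (m, \<sigma>, \<alpha>, r) \<longleftrightarrow> rooted_map {0..<m} \<sigma> \<alpha> r \<and>
     (\<forall>h<m. (r, h) \<in> {(x, y). x < m \<and> (y = \<sigma> x \<or> y = \<alpha> x)}\<^sup>*)"
proof -
  have permutes_iff: "f permutes {0..<m} \<longleftrightarrow> bij_betw f {0..<m} {0..<m} \<and> (\<forall>h\<ge>m. f h = h)" for f
    by (auto simp: permutes_altdef) (metis not_le)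
  have "(\<forall>h. \<alpha> (\<alpha> h) = h) \<longleftrightarrow> (\<forall>h<m. \<alpha> (\<alpha> h) = h)" if "\<forall>h\<ge>m. \<alpha> h = h"
    using that by (metis not_le)
  then show ?thesis
    by (auto simp: is_closed_rooted_map_def rooted_map_def permutes_iff)
qed

locale labelled_map = rooted_map "{0..<m}" \<sigma> \<alpha> r
  for m :: nat and \<sigma> \<alpha> :: "nat \<Rightarrow> nat" and r :: nat
begin

abbreviation "M \<equiv> (m, \<sigma>, \<alpha>, r)"

lemma \<sigma>_less_iff [simp]: "\<sigma> h < m \<longleftrightarrow> h < m"
  using \<sigma>_in_iff[of h] by simp

lemma \<alpha>_less_iff [simp]: "\<alpha> h < m \<longleftrightarrow> h < m"
  using \<alpha>_in_iff[of h] by simp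

lemma root_less [simp]: "r < m"
  using root_in by simp

lemma orbit_\<alpha>: "orbit \<alpha> h = {h, \<alpha> h}"
  by (simp add: orbit_involution)

lemma orbit_\<sigma>_\<sigma>:
  assumes "h < m"
  shows "orbit \<sigma> (\<sigma> h) = orbit \<sigma> h"
proof
  show "orbit \<sigma> (\<sigma> h) \<subseteq> orbit \<sigma> h" by (intro orbit_least orbit_step orbit_self)
  have "orbit \<sigma> (\<sigma> h) \<subseteq> {0..<m}" using assms by (intro orbit_least) auto
  then have "invariant \<sigma> (orbit \<sigma> (\<sigma> h))" by (rule invariant_\<sigma>I) (rule orbit_step)
  then have "h \<in> orbit \<sigma> (\<sigma> h)" using orbit_self[of "\<sigma> h" \<sigma>] by (simp add: invariantD)
  then show "orbit \<sigma> h \<subseteq> orbit \<sigma> (\<sigma> h)" by (intro orbit_least orbit_step)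
qed

lemma map_size: "m + 1 = 2 * map_size M"
proof -
  have "{orbit \<alpha> h |h. h < m} = (\<lambda>h. {h, \<alpha> h}) ` {0..<m}" unfolding orbit_\<alpha> by auto
  then show ?thesis using card_H by (simp add: map_size_def)
qed

lemma adj_without_edge:
  assumes "h < m" "orbit \<alpha> h \<noteq> e"
  shows "(orbit \<sigma> (\<alpha> h), orbit \<sigma> h) \<in> adj_without M e"
proof -
  have "orbit \<sigma> (\<alpha> h) \<in> map_vertices M" "orbit \<sigma> h \<in> map_vertices M" "orbit \<alpha> h \<in> map_edges M"
    using assms(1) by (auto simp: map_vertices_def map_edges_def)
  moreover have "\<alpha> h \<in> orbit \<sigma> (\<alpha> h) \<inter> orbit \<alpha> h" "h \<in> orbit \<sigma> h \<inter> orbit \<alpha> h"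
    by (auto simp: orbit_self orbit_\<alpha>)
  ultimately show ?thesis using assms(2) unfolding adj_without_def by blast
qed

lemma adj_without_disjoint:
  assumes "(v, w) \<in> adj_without M (orbit \<alpha> g)" "invariant \<sigma> T" "exits \<alpha> T \<subseteq> {g}" "v \<inter> T = {}"
  shows "w \<inter> T = {}"
proof (rule ccontr)
  assume "w \<inter> T \<noteq> {}"
  obtain h c where w: "w = orbit \<sigma> h" and edge: "orbit \<alpha> c \<noteq> orbit \<alpha> g"
      "v \<inter> orbit \<alpha> c \<noteq> {}" "w \<inter> orbit \<alpha> c \<noteq> {}"
    using assms(1) unfolding adj_without_def map_vertices_def map_edges_def by auto
  have "h \<in> T" using orbit_disjoint_invariant[OF assms(2), of h] \<open>w \<inter> T \<noteq> {}\<close> w by blast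
  then have "w \<subseteq> T" using orbit_subset_invariant[OF assms(2)] w by blast
  obtain j k where "j \<in> v" "k \<in> w" "j \<in> {c, \<alpha> c}" "k \<in> {c, \<alpha> c}"
    using edge(2,3) unfolding orbit_\<alpha> by blast
  moreover from this have "j \<notin> T" "k \<in> T" using assms(4) \<open>w \<subseteq> T\<close> by auto
  ultimately have "\<alpha> k = j" "k \<in> T" "j \<notin> T" "orbit \<alpha> k = orbit \<alpha> c"
    by (metis \<alpha>_\<alpha> insertE insert_commute orbit_\<alpha> singletonD)+
  then show False using assms(3) edge(1) by (auto simp: exits_def)
qed

lemma bridgeless_imp_bridgeless_map:
  assumes "bridgeless M"
  shows "bridgeless_map {0..<m} \<sigma> \<alpha> r"
proof unfold_locales
  fix T a assume T: "T \<subseteq> {0..<m}" "r \<notin> T" "invariant \<sigma> T" "exits \<alpha> T \<subseteq> {a}"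
  define g where "g = (if a < m then a else r)"
  have g: "g < m" "exits \<alpha> T \<subseteq> {g}" using T(1,4) by (auto simp: g_def exits_def)
  have "h \<notin> T" if "h < m" for h
  proof -
    have "orbit \<sigma> r \<in> map_vertices M" "orbit \<sigma> h \<in> map_vertices M" "orbit \<alpha> g \<in> map_edges M"
      using that g(1) by (auto simp: map_vertices_def map_edges_def)
    then have "(orbit \<sigma> r, orbit \<sigma> h) \<in> (adj_without M (orbit \<alpha> g))\<^sup>*"
      using assms unfolding bridgeless_def is_bridge_def by blast
    then have "orbit \<sigma> h \<inter> T = {}"
    proof (induction rule: rtrancl_induct)
      case base
      show ?case using T(2,3) by (intro orbit_disjoint_invariant)
    next
      case (step v w)
      then show ?case using adj_without_disjoint T(3) g(2) by blast
    qed
    then show ?thesis using orbit_self by blast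
  qed
  then show "T = {}" using T(1) atLeastLessThan_iff by blast
qed

lemma bridgeless_map_imp_reachable:
  assumes "bridgeless_map {0..<m} \<sigma> \<alpha> r" "h < m"
  shows "(r, h) \<in> {(x, y). x < m \<and> (y = \<sigma> x \<or> y = \<alpha> x)}\<^sup>*" (is "_ \<in> ?R\<^sup>*")
proof -
  interpret bridgeless_map "{0..<m}" \<sigma> \<alpha> r by fact
  let ?S = "{h \<in> {0..<m}. (r, h) \<in> ?R\<^sup>*}"
  have "invariant \<sigma> ?S"
    by (intro invariant_\<sigma>I) (auto intro: rtrancl_into_rtrancl)
  moreover have \<alpha>_closed: "\<alpha> k \<in> ?S" if "k \<in> ?S" for k
    using that by (auto intro: rtrancl_into_rtrancl)
  have "\<alpha> k \<in> ?S \<longleftrightarrow> k \<in> ?S" for k using \<alpha>_closed[of k] \<alpha>_closed[of "\<alpha> k"] by auto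
  ultimately have "{0..<m} - ?S = {}"
    by (intro cut_condition[of _ r]) (auto simp: invariant_def exits_def)
  then show ?thesis using assms(2) by auto
qed

lemma bridgeless_map_imp_connected_without:
  assumes "bridgeless_map {0..<m} \<sigma> \<alpha> r" "h < m"
  shows "(orbit \<sigma> r, orbit \<sigma> h) \<in> (adj_without M (orbit \<alpha> g))\<^sup>*" (is "_ \<in> ?A\<^sup>*")
proof -
  interpret bridgeless_map "{0..<m}" \<sigma> \<alpha> r by fact
  let ?T = "{h \<in> {0..<m}. (orbit \<sigma> r, orbit \<sigma> h) \<notin> ?A\<^sup>*}"
  have "?T = {}"
  proof (rule cut_condition)
    show "invariant \<sigma> ?T" by (intro invariant_\<sigma>I) (auto simp: orbit_\<sigma>_\<sigma>)
    show "exits \<alpha> ?T \<subseteq> {if g \<in> ?T then g else \<alpha> g}"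
    proof
      fix k assume k: "k \<in> exits \<alpha> ?T"
      then have "k < m" "(orbit \<sigma> r, orbit \<sigma> (\<alpha> k)) \<in> ?A\<^sup>*" "(orbit \<sigma> r, orbit \<sigma> k) \<notin> ?A\<^sup>*"
        by (auto simp: exits_def)
      then have "orbit \<alpha> k = orbit \<alpha> g"
        using adj_without_edge[of k "orbit \<alpha> g"] by (meson rtrancl_into_rtrancl)
      then have "k = g \<or> k = \<alpha> g" unfolding orbit_\<alpha> by blast
      then show "k \<in> {if g \<in> ?T then g else \<alpha> g}" using k by (auto simp: exits_def)
    qed
  qed auto
  then show ?thesis using assms(2) by auto
qed

lemma closed_bridgeless_iff: "is_closed_rooted_map M \<and> bridgeless M \<longleftrightarrow> bridgeless_map {0..<m} \<sigma> \<alpha> r"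
proof
  show "bridgeless_map {0..<m} \<sigma> \<alpha> r" if "is_closed_rooted_map M \<and> bridgeless M"
    using that bridgeless_imp_bridgeless_map by blast
next
  assume bridgeless: "bridgeless_map {0..<m} \<sigma> \<alpha> r"
  have "sym (adj_without M e)" for e by (auto simp: sym_def adj_without_def)
  then have "sym ((adj_without M e)\<^sup>*)" for e by (rule sym_rtrancl)
  then have "(v, w) \<in> (adj_without M e)\<^sup>*"
    if "e \<in> map_edges M" "v \<in> map_vertices M" "w \<in> map_vertices M" for e v w
    using that bridgeless_map_imp_connected_without[OF bridgeless]
    unfolding map_edges_def map_vertices_def
    by clarsimp (blast intro: rtrancl_trans dest: symD)
  then show "is_closed_rooted_map M \<and> bridgeless M"
    using bridgeless_map_imp_reachable[OF bridgeless] rooted_map_axioms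
    unfolding is_closed_rooted_map_iff bridgeless_def is_bridge_def by blast
qed

end

lemma bridgeless_maps_eq:
  assumes "n \<ge> 1"
  shows "bridgeless_maps n = {2 * n - 1} \<times> bridgeless_maps_on {0..<2 * n - 1}"
proof -
  have "(m, \<sigma>, \<alpha>, r) \<in> bridgeless_maps n \<longleftrightarrow> m = 2 * n - 1 \<and> bridgeless_map {0..<m} \<sigma> \<alpha> r" for m \<sigma> \<alpha> r
  proof (cases "rooted_map {0..<m} \<sigma> \<alpha> r")
    case True
    then interpret labelled_map m \<sigma> \<alpha> r by (rule labelled_map.intro)
    have "map_size (m, \<sigma>, \<alpha>, r) = n \<longleftrightarrow> m = 2 * n - 1" using map_size assms by auto
    then show ?thesis using closed_bridgeless_iff by (auto simp: bridgeless_maps_def)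
  next
    case False
    then show ?thesis
      by (auto simp: bridgeless_maps_def is_closed_rooted_map_iff bridgeless_map_def)
  qed
  then show ?thesis by auto
qed

section \<open>Isomorphism classes\<close>

lemma map_iso_iff_relabel:
  assumes M: "M \<in> bridgeless_maps_on {0..<m}" and M': "M' \<in> bridgeless_maps_on {0..<m}"
  shows "map_iso (m, M) (m, M') \<longleftrightarrow> (\<exists>\<phi>. \<phi> permutes {0..<m} \<and> M' = relabel {0..<m} \<phi> M)"
proof -
  obtain \<sigma> \<alpha> r \<sigma>' \<alpha>' r' where eq: "M = (\<sigma>, \<alpha>, r)" "M' = (\<sigma>', \<alpha>', r')" by (cases M; cases M')
  have relabel_iff: "M' = relabel {0..<m} \<phi> M \<longleftrightarrow>
      (\<forall>h<m. \<phi> (\<sigma> h) = \<sigma>' (\<phi> h) \<and> \<phi> (\<alpha> h) = \<alpha>' (\<phi> h)) \<and> \<phi> r = r'"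
    if "bij_betw \<phi> {0..<m} {0..<m}" for \<phi>
    using relabel_eq_iff[OF M'[unfolded eq] that, of \<sigma> \<alpha> r] by (auto simp: eq)
  have "relabel {0..<m} (restrict_id \<phi> {0..<m}) M = relabel {0..<m} \<phi> M"
    if "bij_betw \<phi> {0..<m} {0..<m}" for \<phi>
    using M that unfolding eq
    by (auto simp: relabel_def bridgeless_map_def rooted_map_def bij_betw_def inj_on_def
        intro!: map_permutation_cong)
  then have "(\<exists>\<phi>. bij_betw \<phi> {0..<m} {0..<m} \<and> M' = relabel {0..<m} \<phi> M) \<longleftrightarrow>
      (\<exists>\<phi>. \<phi> permutes {0..<m} \<and> M' = relabel {0..<m} \<phi> M)"
    by (metis permutes_imp_bij permutes_restrict_id)
  then show ?thesis using relabel_iff by (auto simp: map_iso_def eq)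
qed

abbreviation map_iso_rel :: "nat \<Rightarrow> (cmap \<times> cmap) set" where
  "map_iso_rel n \<equiv> {(M, M'). M \<in> bridgeless_maps n \<and> M' \<in> bridgeless_maps n \<and> map_iso M M'}"

lemma card_map_iso_class:
  assumes "n \<ge> 1" "M \<in> bridgeless_maps_on {0..<2 * n - 1}"
  shows "card (map_iso_rel n `` {(2 * n - 1, M)}) = fact (2 * n - 1)"
proof -
  let ?H = "{0..<2 * n - 1}"
  have "map_iso_rel n `` {(2 * n - 1, M)} =
      Pair (2 * n - 1) ` (\<lambda>\<phi>. relabel ?H \<phi> M) ` {\<phi>. \<phi> permutes ?H}"
  proof (intro equalityI subsetI)
    fix N assume "N \<in> map_iso_rel n `` {(2 * n - 1, M)}"
    then obtain M' where "N = (2 * n - 1, M')" "M' \<in> bridgeless_maps_on ?H"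
      "map_iso (2 * n - 1, M) (2 * n - 1, M')"
      unfolding bridgeless_maps_eq[OF assms(1)] by auto
    then show "N \<in> Pair (2 * n - 1) ` (\<lambda>\<phi>. relabel ?H \<phi> M) ` {\<phi>. \<phi> permutes ?H}"
      using map_iso_iff_relabel[OF assms(2)] by blast
  next
    fix N assume "N \<in> Pair (2 * n - 1) ` (\<lambda>\<phi>. relabel ?H \<phi> M) ` {\<phi>. \<phi> permutes ?H}"
    then obtain \<phi> where \<phi>: "\<phi> permutes ?H" "N = (2 * n - 1, relabel ?H \<phi> M)" by blast
    have relabelled: "relabel ?H \<phi> M \<in> bridgeless_maps_on ?H"
      using assms(2) permutes_imp_bij[OF \<phi>(1)] by (rule relabel_in_bridgeless_maps_on)
    moreover have "map_iso (2 * n - 1, M) (2 * n - 1, relabel ?H \<phi> M)"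
      using map_iso_iff_relabel[OF assms(2) relabelled] \<phi>(1) by blast
    ultimately show "N \<in> map_iso_rel n `` {(2 * n - 1, M)}"
      using \<phi>(2) assms(2) unfolding bridgeless_maps_eq[OF assms(1)] by simp
  qed
  moreover have "inj_on (Pair (2 * n - 1)) ((\<lambda>\<phi>. relabel ?H \<phi> M) ` {\<phi>. \<phi> permutes ?H})"
    by (rule inj_onI) simp
  ultimately show ?thesis using card_relabellings[OF assms(2)] by (simp add: card_image)
qed

lemma equiv_map_iso_rel:
  assumes "n \<ge> 1"
  shows "equiv (bridgeless_maps n) (map_iso_rel n)"
proof (rule equivI)
  let ?H = "{0..<2 * n - 1}"
  note [simp] = bridgeless_maps_eq[OF assms]
  show "refl_on (bridgeless_maps n) (map_iso_rel n)"
    by (auto simp: refl_on_def map_iso_def intro!: exI[of _ id])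
  show "sym (map_iso_rel n)"
  proof (rule symI)
    fix M M' assume MM': "(M, M') \<in> map_iso_rel n"
    then obtain N N' where eq: "M = (2 * n - 1, N)" "M' = (2 * n - 1, N')"
      and N: "N \<in> bridgeless_maps_on ?H" "N' \<in> bridgeless_maps_on ?H" by auto
    then obtain \<phi> where \<phi>: "\<phi> permutes ?H" "N' = relabel ?H \<phi> N"
      using MM' map_iso_iff_relabel by auto
    then have "N = relabel ?H (inv \<phi>) N'"
      using relabel_inverse[OF N(1) permutes_imp_bij[OF \<phi>(1)], of "inv \<phi>"]
      by (simp add: permutes_inverses)
    then show "(M', M) \<in> map_iso_rel n"
      using MM' permutes_inv[OF \<phi>(1)] map_iso_iff_relabel[OF N(2,1)] eq by auto
  qed
  show "trans (map_iso_rel n)"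
  proof (rule transI)
    fix M M' M'' assume MM': "(M, M') \<in> map_iso_rel n" and M'M'': "(M', M'') \<in> map_iso_rel n"
    then obtain N N' N''
      where eq: "M = (2 * n - 1, N)" "M' = (2 * n - 1, N')" "M'' = (2 * n - 1, N'')"
      and N: "N \<in> bridgeless_maps_on ?H" "N' \<in> bridgeless_maps_on ?H" "N'' \<in> bridgeless_maps_on ?H"
      by auto
    then obtain \<phi> \<psi> where \<phi>: "\<phi> permutes ?H" "N' = relabel ?H \<phi> N"
      and \<psi>: "\<psi> permutes ?H" "N'' = relabel ?H \<psi> N'"
      using MM' M'M'' map_iso_iff_relabel by auto
    then have "N'' = relabel ?H (\<psi> \<circ> \<phi>) N"
      using relabel_compose[OF permutes_imp_bij permutes_inj_on] by metis
    then show "(M, M'') \<in> map_iso_rel n"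
      using MM' M'M'' permutes_compose[OF \<phi>(1) \<psi>(1)] map_iso_iff_relabel[OF N(1,3)] eq by auto
  qed
qed auto

lemma num_bridgeless_maps_fact:
  assumes "n \<ge> 1"
  shows "fact (2 * n - 1) * num_bridgeless_maps n = card (bridgeless_maps_on {0..<2 * n - 1})"
proof -
  let ?B = "bridgeless_maps n"
  have finite: "finite ?B" using assms by (simp add: bridgeless_maps_eq finite_bridgeless_maps_on)
  have equiv: "equiv ?B (map_iso_rel n)" using assms by (rule equiv_map_iso_rel)
  have "fact (2 * n - 1) * card (?B // map_iso_rel n) = card (\<Union> (?B // map_iso_rel n))"
  proof (rule card_partition)
    show "finite (?B // map_iso_rel n)" using finite by (rule finite_quotient) auto
    show "finite (\<Union> (?B // map_iso_rel n))" using finite equiv by (simp add: Union_quotient)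
    show "c \<inter> c' = {}" if "c \<in> ?B // map_iso_rel n" "c' \<in> ?B // map_iso_rel n" "c \<noteq> c'" for c c'
      using quotient_disj[OF equiv] that by blast
    show "card c = fact (2 * n - 1)" if "c \<in> ?B // map_iso_rel n" for c
    proof -
      obtain M where "M \<in> bridgeless_maps_on {0..<2 * n - 1}"
        "c = map_iso_rel n `` {(2 * n - 1, M)}"
        using \<open>c \<in> _\<close> bridgeless_maps_eq[OF assms] by (auto elim!: quotientE)
      then show ?thesis using card_map_iso_class[OF assms] by simp
    qed
  qed
  also have "\<Union> (?B // map_iso_rel n) = ?B" using equiv by (rule Union_quotient)
  finally show ?thesis
    using assms by (simp add: num_bridgeless_maps_def bridgeless_maps_eq card_cartesian_product)
qed

lemma num_bridgeless_maps_1: "num_bridgeless_maps 1 = 1"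
  using num_bridgeless_maps_fact[of 1] by (simp add: bridgeless_maps_on_singleton)

section \<open>Gluing\<close>

text \<open>With \<open>x = \<sigma>\<^sub>2 r\<^sub>2\<close>, the half-edge \<open>u\<close> is inserted into the corner after \<open>i\<close>, joined to \<open>r\<^sub>2\<close>
  by a new edge, and then \<open>x\<close> is moved to the corner after \<open>r\<^sub>1\<close>. If the second map has size 1 then
  \<open>x = r\<^sub>2\<close>, and the result is the first map with an edge \<open>{x, u}\<close> attached.\<close>

definition glue :: "'a \<Rightarrow> 'a \<Rightarrow> 'a rmap \<Rightarrow> 'a rmap \<Rightarrow> 'a rmap" where
  "glue u i = (\<lambda>(\<sigma>\<^sub>1, \<alpha>\<^sub>1, r\<^sub>1) (\<sigma>\<^sub>2, \<alpha>\<^sub>2, r\<^sub>2).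
     (\<sigma>\<^sub>1 \<circ> \<sigma>\<^sub>2 \<circ> transpose i u \<circ> transpose r\<^sub>1 r\<^sub>2 \<circ> transpose r\<^sub>2 (\<sigma>\<^sub>2 r\<^sub>2),
      \<alpha>\<^sub>1 \<circ> \<alpha>\<^sub>2 \<circ> transpose u r\<^sub>2, r\<^sub>1))"

text \<open>After deleting the edge of \<open>\<sigma> r\<close>, a root side is a union of vertices containing the root
  with a single exit: the edge of \<open>u\<close> is then a bridge, or \<open>u = \<alpha> (\<sigma> r)\<close>.\<close>

definition (in rooted_map) root_side :: "'a set \<Rightarrow> 'a \<Rightarrow> bool" where
  "root_side S u \<longleftrightarrow> S \<subseteq> H \<and> r \<in> S \<and> \<sigma> r \<notin> S \<and> invariant \<sigma> (insert (\<sigma> r) S) \<and> exits \<alpha> S = {u}"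

locale gluing = M\<^sub>1: rooted_map H\<^sub>1 \<sigma>\<^sub>1 \<alpha>\<^sub>1 r\<^sub>1 + M\<^sub>2: rooted_map H\<^sub>2 \<sigma>\<^sub>2 \<alpha>\<^sub>2 r\<^sub>2
  for H\<^sub>1 :: "'a set" and \<sigma>\<^sub>1 \<alpha>\<^sub>1 r\<^sub>1 and H\<^sub>2 :: "'a set" and \<sigma>\<^sub>2 \<alpha>\<^sub>2 r\<^sub>2 +
  fixes i u :: 'a
  assumes i_in [simp]: "i \<in> H\<^sub>1" and disjoint: "H\<^sub>1 \<inter> H\<^sub>2 = {}"
    and u_notin [simp]: "u \<notin> H\<^sub>1" "u \<notin> H\<^sub>2"
begin

definition "H = insert u (H\<^sub>1 \<union> H\<^sub>2)"
definition "x = \<sigma>\<^sub>2 r\<^sub>2"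
definition "\<sigma> = \<sigma>\<^sub>1 \<circ> \<sigma>\<^sub>2 \<circ> transpose i u \<circ> transpose r\<^sub>1 r\<^sub>2 \<circ> transpose r\<^sub>2 x"
definition "\<alpha> = \<alpha>\<^sub>1 \<circ> \<alpha>\<^sub>2 \<circ> transpose u r\<^sub>2"

lemma glue_eq: "glue u i (\<sigma>\<^sub>1, \<alpha>\<^sub>1, r\<^sub>1) (\<sigma>\<^sub>2, \<alpha>\<^sub>2, r\<^sub>2) = (\<sigma>, \<alpha>, r\<^sub>1)"
  by (simp add: glue_def \<sigma>_def \<alpha>_def x_def)

lemma x_in [simp]: "x \<in> H\<^sub>2"
  by (simp add: x_def)

lemma not_in_both: "h \<in> H\<^sub>1 \<Longrightarrow> h \<notin> H\<^sub>2" "h \<in> H\<^sub>2 \<Longrightarrow> h \<notin> H\<^sub>1"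
  using disjoint by auto

lemma notin_other_side [simp]: "r\<^sub>1 \<notin> H\<^sub>2" "i \<notin> H\<^sub>2" "r\<^sub>2 \<notin> H\<^sub>1" "x \<notin> H\<^sub>1"
  using not_in_both by simp_all

lemma neqs [simp]:
  "r\<^sub>1 \<noteq> u" "i \<noteq> u" "r\<^sub>2 \<noteq> u" "x \<noteq> u" "r\<^sub>1 \<noteq> r\<^sub>2" "i \<noteq> r\<^sub>2" "i \<noteq> x" "r\<^sub>1 \<noteq> x"
    "u \<noteq> r\<^sub>1" "u \<noteq> i" "u \<noteq> r\<^sub>2" "u \<noteq> x" "r\<^sub>2 \<noteq> r\<^sub>1" "r\<^sub>2 \<noteq> i" "x \<noteq> i" "x \<noteq> r\<^sub>1"
  using M\<^sub>1.root_in M\<^sub>2.root_in i_in x_in u_notin not_in_both by metis+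

lemma \<sigma>\<^sub>1_\<sigma>\<^sub>2: "h \<in> H\<^sub>1 \<Longrightarrow> \<sigma>\<^sub>1 (\<sigma>\<^sub>2 h) = \<sigma>\<^sub>1 h" "h \<in> H\<^sub>2 \<Longrightarrow> \<sigma>\<^sub>1 (\<sigma>\<^sub>2 h) = \<sigma>\<^sub>2 h" "\<sigma>\<^sub>1 (\<sigma>\<^sub>2 u) = u"
  by (simp_all add: M\<^sub>1.\<sigma>_outside M\<^sub>2.\<sigma>_outside not_in_both)

lemma \<sigma>_r\<^sub>1: "\<sigma> r\<^sub>1 = x"
  by (simp add: \<sigma>_def \<sigma>\<^sub>1_\<sigma>\<^sub>2 transpose_def) (simp add: x_def)

lemma \<sigma>_x: "i \<noteq> r\<^sub>1 \<Longrightarrow> \<sigma> x = \<sigma>\<^sub>1 r\<^sub>1" and \<sigma>_x_root: "i = r\<^sub>1 \<Longrightarrow> \<sigma> x = u"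
  unfolding \<sigma>_def by (auto simp: \<sigma>\<^sub>1_\<sigma>\<^sub>2 transpose_def)

lemma \<sigma>_i: "i \<noteq> r\<^sub>1 \<Longrightarrow> \<sigma> i = u"
  by (simp add: \<sigma>_def \<sigma>\<^sub>1_\<sigma>\<^sub>2 transpose_def)

lemma \<sigma>_u: "\<sigma> u = \<sigma>\<^sub>1 i"
  by (simp add: \<sigma>_def \<sigma>\<^sub>1_\<sigma>\<^sub>2 transpose_def)

lemma \<sigma>_H\<^sub>1: "h \<in> H\<^sub>1 \<Longrightarrow> h \<noteq> r\<^sub>1 \<Longrightarrow> h \<noteq> i \<Longrightarrow> \<sigma> h = \<sigma>\<^sub>1 h"
  using not_in_both(1)[of h] by (auto simp: \<sigma>_def M\<^sub>2.\<sigma>_outside transpose_def)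

lemma \<sigma>_H\<^sub>2: "h \<in> H\<^sub>2 \<Longrightarrow> h \<noteq> r\<^sub>2 \<Longrightarrow> h \<noteq> x \<Longrightarrow> \<sigma> h = \<sigma>\<^sub>2 h"
  using not_in_both(2)[of h] by (auto simp: \<sigma>_def \<sigma>\<^sub>1_\<sigma>\<^sub>2 transpose_def)

lemma \<alpha>_u: "\<alpha> u = r\<^sub>2" and \<alpha>_r\<^sub>2: "\<alpha> r\<^sub>2 = u"
  by (simp_all add: \<alpha>_def M\<^sub>1.\<alpha>_outside M\<^sub>2.\<alpha>_outside)

lemma \<alpha>_H\<^sub>1: "h \<in> H\<^sub>1 \<Longrightarrow> \<alpha> h = \<alpha>\<^sub>1 h"
  using not_in_both(1)[of h] by (auto simp: \<alpha>_def M\<^sub>2.\<alpha>_outside transpose_def)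

lemma \<alpha>_H\<^sub>2: "h \<in> H\<^sub>2 \<Longrightarrow> h \<noteq> r\<^sub>2 \<Longrightarrow> \<alpha> h = \<alpha>\<^sub>2 h"
  using not_in_both(2)[of "\<alpha>\<^sub>2 h"] by (auto simp: \<alpha>_def M\<^sub>1.\<alpha>_outside transpose_def)

sublocale glued: rooted_map H \<sigma> \<alpha> r\<^sub>1
proof
  show "finite H" by (simp add: H_def M\<^sub>1.finite_H M\<^sub>2.finite_H)
  show "r\<^sub>1 \<in> H" by (simp add: H_def)
  have permutes: "f permutes H" if "f permutes H\<^sub>1 \<or> f permutes H\<^sub>2" for f
    using that permutes_subset[of f _ H] by (auto simp: H_def)
  have transposes: "transpose i u permutes H" "transpose r\<^sub>1 r\<^sub>2 permutes H"
    "transpose r\<^sub>2 x permutes H" "transpose u r\<^sub>2 permutes H"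
    by (simp_all add: permutes_swap_id H_def)
  show "\<sigma> permutes H"
    unfolding \<sigma>_def using transposes permutes M\<^sub>1.\<sigma>_permutes M\<^sub>2.\<sigma>_permutes
    by (simp add: permutes_compose)
  show \<alpha>_permutes: "\<alpha> permutes H"
    unfolding \<alpha>_def using transposes permutes M\<^sub>1.\<alpha>_permutes M\<^sub>2.\<alpha>_permutes
    by (simp add: permutes_compose)
  have \<alpha>_involution: "\<alpha> (\<alpha> h) = h \<and> (\<alpha> h = h \<longleftrightarrow> h = r\<^sub>1)" if "h \<in> H" for h
  proof -
    consider "h = u" | "h \<in> H\<^sub>1" | "h = r\<^sub>2" | "h \<in> H\<^sub>2" "h \<noteq> r\<^sub>2"
      using \<open>h \<in> H\<close> by (auto simp: H_def)
    then show ?thesis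
      by cases (auto simp: \<alpha>_u \<alpha>_r\<^sub>2 \<alpha>_H\<^sub>1 \<alpha>_H\<^sub>2 M\<^sub>1.\<alpha>_fixed_iff M\<^sub>2.\<alpha>_fixed_iff)
  qed
  then show "\<alpha> h = h \<longleftrightarrow> h = r\<^sub>1" if "h \<in> H" for h using that by blast
  show "\<alpha> (\<alpha> h) = h" for h
    using \<alpha>_involution[of h] permutes_not_in[OF \<alpha>_permutes, of h] by (cases "h \<in> H") auto
qed

lemma u_in_iff_i_in:
  assumes "invariant \<sigma> T" "r\<^sub>1 \<notin> T"
  shows "u \<in> T \<longleftrightarrow> i \<in> T"
proof (cases "i = r\<^sub>1")
  case True
  have "x \<notin> T" using assms(2) invariantD[OF assms(1), of r\<^sub>1] by (simp add: \<sigma>_r\<^sub>1)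
  then have "u \<notin> T" using invariantD[OF assms(1), of x] unfolding \<sigma>_x_root[OF True] by blast
  then show ?thesis using assms(2) True by blast
next
  case False
  then show ?thesis using invariantD[OF assms(1), of i] by (simp add: \<sigma>_i)
qed

lemma invariant_\<sigma>\<^sub>1_Int:
  assumes "invariant \<sigma> T" "r\<^sub>1 \<notin> T"
  shows "invariant \<sigma>\<^sub>1 (T \<inter> H\<^sub>1)"
proof (rule M\<^sub>1.invariant_\<sigma>I)
  fix h assume h: "h \<in> T \<inter> H\<^sub>1"
  then have "h \<noteq> r\<^sub>1" using assms(2) by auto
  show "\<sigma>\<^sub>1 h \<in> T \<inter> H\<^sub>1"
  proof (cases "h = i")
    case True
    then show ?thesis
      using h u_in_iff_i_in[OF assms] invariantD[OF assms(1), of u] by (simp add: \<sigma>_u)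
  next
    case False
    then show ?thesis
      using h \<open>h \<noteq> r\<^sub>1\<close> invariantD[OF assms(1), of h] by (simp add: \<sigma>_H\<^sub>1)
  qed
qed auto

lemma exits_\<alpha>\<^sub>1_Int: "exits \<alpha>\<^sub>1 (T \<inter> H\<^sub>1) \<subseteq> exits \<alpha> T"
  by (auto simp: exits_def \<alpha>_H\<^sub>1)

lemma cut_condition_H\<^sub>2:
  assumes "bridgeless_map H\<^sub>2 \<sigma>\<^sub>2 \<alpha>\<^sub>2 r\<^sub>2" and "r\<^sub>2 \<notin> T"
    and T: "T \<subseteq> H\<^sub>2" "x \<notin> T" "invariant \<sigma> T" "exits \<alpha> T \<subseteq> {a}"
  shows "T = {}"
proof -
  interpret M\<^sub>2: bridgeless_map H\<^sub>2 \<sigma>\<^sub>2 \<alpha>\<^sub>2 r\<^sub>2 by fact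
  show ?thesis
  proof (rule M\<^sub>2.cut_condition[OF T(1) assms(2)])
    show "invariant \<sigma>\<^sub>2 T"
    proof (rule M\<^sub>2.invariant_\<sigma>I[OF T(1)])
      show "\<sigma>\<^sub>2 h \<in> T" if "h \<in> T" for h
        using that T(1,2) assms(2) invariantD[OF T(3), of h] \<sigma>_H\<^sub>2[of h] by force
    qed
    have "\<alpha> h = \<alpha>\<^sub>2 h" if "h \<in> T" for h using that T(1) assms(2) by (blast intro: \<alpha>_H\<^sub>2)
    then have "exits \<alpha>\<^sub>2 T = exits \<alpha> T" by (auto simp: exits_def)
    then show "exits \<alpha>\<^sub>2 T \<subseteq> {a}" using T(4) by simp
  qed
qed

text \<open>If the only exit of \<open>T\<close> is \<open>r\<^sub>2\<close>, then the other half-edges of the second map, without \<open>x\<close>,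
  would have their only exit along the edge of \<open>x\<close>.\<close>

lemma r\<^sub>2_notin_one_exit_set:
  assumes "bridgeless_map H\<^sub>2 \<sigma>\<^sub>2 \<alpha>\<^sub>2 r\<^sub>2"
    and T: "T \<subseteq> H\<^sub>2" "x \<notin> T" "invariant \<sigma> T" "exits \<alpha> T \<subseteq> {a}"
  shows "r\<^sub>2 \<notin> T"
proof
  assume "r\<^sub>2 \<in> T"
  interpret M\<^sub>2: bridgeless_map H\<^sub>2 \<sigma>\<^sub>2 \<alpha>\<^sub>2 r\<^sub>2 by fact
  have "x \<noteq> r\<^sub>2" "u \<notin> T" using \<open>r\<^sub>2 \<in> T\<close> T(1,2) by auto
  then have "r\<^sub>2 \<in> exits \<alpha> T" using \<open>r\<^sub>2 \<in> T\<close> by (simp add: exits_def \<alpha>_r\<^sub>2)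
  then have exit_r\<^sub>2: "exits \<alpha> T \<subseteq> {r\<^sub>2}" using T(4) by auto
  have no_exit: "\<alpha>\<^sub>2 h \<in> T" if "h \<in> T" "h \<noteq> r\<^sub>2" for h
  proof -
    have "h \<notin> exits \<alpha> T" using that(2) exit_r\<^sub>2 by blast
    moreover have "\<alpha> h = \<alpha>\<^sub>2 h" using that T(1) by (blast intro: \<alpha>_H\<^sub>2)
    ultimately show ?thesis using that(1) by (simp add: exits_def)
  qed
  let ?U = "H\<^sub>2 - insert x T"
  have "?U = {}"
  proof (rule M\<^sub>2.cut_condition)
    show "r\<^sub>2 \<notin> ?U" using \<open>r\<^sub>2 \<in> T\<close> by simp
    show "invariant \<sigma>\<^sub>2 ?U"
    proof (rule M\<^sub>2.invariant_\<sigma>I)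
      fix h assume h: "h \<in> ?U"
      then have "h \<noteq> r\<^sub>2" using \<open>r\<^sub>2 \<in> T\<close> by auto
      then have "\<sigma>\<^sub>2 h \<notin> T" using h invariantD[OF T(3), of h] by (auto simp: \<sigma>_H\<^sub>2)
      moreover have "\<sigma>\<^sub>2 h \<noteq> x" using \<open>h \<noteq> r\<^sub>2\<close> by (simp add: x_def)
      ultimately show "\<sigma>\<^sub>2 h \<in> ?U" using h by simp
    qed auto
    show "exits \<alpha>\<^sub>2 ?U \<subseteq> {\<alpha>\<^sub>2 x}"
    proof
      fix h assume h: "h \<in> exits \<alpha>\<^sub>2 ?U"
      have "\<alpha>\<^sub>2 h \<notin> T"
        using no_exit[of "\<alpha>\<^sub>2 h"] h \<open>r\<^sub>2 \<in> T\<close> by (auto simp: exits_def)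
      then have "x = \<alpha>\<^sub>2 h" using h by (auto simp: exits_def)
      then show "h \<in> {\<alpha>\<^sub>2 x}" by simp
    qed
  qed auto
  moreover have "\<alpha>\<^sub>2 x \<noteq> x" using \<open>x \<noteq> r\<^sub>2\<close> by (simp add: M\<^sub>2.\<alpha>_fixed_iff)
  moreover have "\<alpha>\<^sub>2 x \<in> H\<^sub>2" by simp
  ultimately have "\<alpha>\<^sub>2 x \<in> T" by blast
  then show False using no_exit[of "\<alpha>\<^sub>2 x"] T(2) \<open>x \<noteq> r\<^sub>2\<close> by auto
qed

lemma bridgeless_glued:
  assumes "bridgeless_map H\<^sub>1 \<sigma>\<^sub>1 \<alpha>\<^sub>1 r\<^sub>1" and "bridgeless_map H\<^sub>2 \<sigma>\<^sub>2 \<alpha>\<^sub>2 r\<^sub>2"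
  shows "bridgeless_map H \<sigma> \<alpha> r\<^sub>1"
proof unfold_locales
  fix T a assume T: "T \<subseteq> H" "r\<^sub>1 \<notin> T" "invariant \<sigma> T" "exits \<alpha> T \<subseteq> {a}"
  interpret M\<^sub>1: bridgeless_map H\<^sub>1 \<sigma>\<^sub>1 \<alpha>\<^sub>1 r\<^sub>1 by fact
  have "T \<inter> H\<^sub>1 = {}"
    using T exits_\<alpha>\<^sub>1_Int[of T] by (intro M\<^sub>1.cut_condition[of _ a] invariant_\<sigma>\<^sub>1_Int) auto
  moreover from this have "u \<notin> T" using u_in_iff_i_in[OF T(3,2)] i_in by blast
  ultimately have "T \<subseteq> H\<^sub>2" using T(1) by (auto simp: H_def)
  moreover have "x \<notin> T" using T(2) invariantD[OF T(3), of r\<^sub>1] by (simp add: \<sigma>_r\<^sub>1)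
  ultimately show "T = {}"
    using assms(2) T(3,4) cut_condition_H\<^sub>2 r\<^sub>2_notin_one_exit_set by blast
qed

lemma root_side_glued: "glued.root_side (insert u H\<^sub>1) u"
proof -
  have "invariant \<sigma> (insert x (insert u H\<^sub>1))"
  proof (rule glued.invariant_\<sigma>I)
    show "insert x (insert u H\<^sub>1) \<subseteq> H" by (auto simp: H_def)
    fix h assume h: "h \<in> insert x (insert u H\<^sub>1)"
    have \<sigma>_x_in: "\<sigma> x \<in> insert u H\<^sub>1"
      using \<sigma>_x \<sigma>_x_root M\<^sub>1.\<sigma>_in_iff[of r\<^sub>1] by (cases "i = r\<^sub>1") auto
    consider "h = x" | "h = u" | "h = r\<^sub>1" | "h = i" "i \<noteq> r\<^sub>1" | "h \<in> H\<^sub>1" "h \<noteq> r\<^sub>1" "h \<noteq> i"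
      using h by auto
    then show "\<sigma> h \<in> insert x (insert u H\<^sub>1)"
      by cases (use \<sigma>_x_in in \<open>simp_all add: \<sigma>_u \<sigma>_i \<sigma>_r\<^sub>1 \<sigma>_H\<^sub>1\<close>)
  qed
  then show ?thesis
    unfolding glued.root_side_def \<sigma>_r\<^sub>1 by (auto simp: H_def exits_def \<alpha>_u \<alpha>_H\<^sub>1)
qed

lemma root_side_least:
  assumes "bridgeless_map H\<^sub>1 \<sigma>\<^sub>1 \<alpha>\<^sub>1 r\<^sub>1" and "glued.root_side S w"
  shows "insert u H\<^sub>1 \<subseteq> S"
proof -
  interpret M\<^sub>1: bridgeless_map H\<^sub>1 \<sigma>\<^sub>1 \<alpha>\<^sub>1 r\<^sub>1 by fact
  have S: "r\<^sub>1 \<in> S" "x \<notin> S" "invariant \<sigma> (insert x S)" "exits \<alpha> S = {w}"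
    using assms(2) by (auto simp: glued.root_side_def \<sigma>_r\<^sub>1)
  let ?T = "- insert x S"
  have T: "invariant \<sigma> ?T" "r\<^sub>1 \<notin> ?T" using S(1,3) by (auto simp: invariant_def)
  have "?T \<inter> H\<^sub>1 = {}"
  proof (rule M\<^sub>1.cut_condition)
    show "invariant \<sigma>\<^sub>1 (?T \<inter> H\<^sub>1)" using T by (rule invariant_\<sigma>\<^sub>1_Int)
    show "exits \<alpha>\<^sub>1 (?T \<inter> H\<^sub>1) \<subseteq> {\<alpha>\<^sub>1 w}"
    proof
      fix h assume h: "h \<in> exits \<alpha>\<^sub>1 (?T \<inter> H\<^sub>1)"
      then have "\<alpha>\<^sub>1 h \<in> H\<^sub>1" by (simp add: exits_def)
      then have "\<alpha>\<^sub>1 h \<noteq> x" using notin_other_side(4) by metis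
      then have "\<alpha>\<^sub>1 h \<in> exits \<alpha> S" using h by (auto simp: exits_def \<alpha>_H\<^sub>1)
      then have "w = \<alpha>\<^sub>1 h" using S(4) by simp
      then show "h \<in> {\<alpha>\<^sub>1 w}" by simp
    qed
  qed (use S(1) in auto)
  then have "H\<^sub>1 \<subseteq> insert x S" by blast
  then have "H\<^sub>1 \<subseteq> S" by (simp add: subset_insert)
  moreover have "u \<in> S" using u_in_iff_i_in[OF T] calculation by auto
  ultimately show ?thesis by blast
qed

lemma i_eq: "i = (if \<sigma> x = u then r\<^sub>1 else inv \<sigma> u)"
proof (cases "i = r\<^sub>1")
  case True
  show ?thesis unfolding if_P[OF \<sigma>_x_root[OF True]] by (rule True)
next
  case False
  then have "inv \<sigma> u = i" using permutes_inv_eq[OF glued.\<sigma>_permutes] \<sigma>_i by blast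
  moreover have "\<sigma>\<^sub>1 r\<^sub>1 \<noteq> u" using M\<^sub>1.\<sigma>_in_iff[of r\<^sub>1] u_notin(1) by fastforce
  ultimately show ?thesis using False by (simp add: \<sigma>_x)
qed

lemma \<sigma>\<^sub>1_\<sigma>\<^sub>2_eq: "\<sigma>\<^sub>1 \<circ> \<sigma>\<^sub>2 = \<sigma> \<circ> transpose r\<^sub>2 x \<circ> transpose r\<^sub>1 r\<^sub>2 \<circ> transpose i u"
  by (simp add: \<sigma>_def fun_eq_iff)

lemma \<alpha>\<^sub>1_\<alpha>\<^sub>2_eq: "\<alpha>\<^sub>1 \<circ> \<alpha>\<^sub>2 = \<alpha> \<circ> transpose u r\<^sub>2"
  by (simp add: \<alpha>_def fun_eq_iff)

lemma restrict_id_parts: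
  "restrict_id (\<sigma>\<^sub>1 \<circ> \<sigma>\<^sub>2) H\<^sub>1 = \<sigma>\<^sub>1" "restrict_id (\<sigma>\<^sub>1 \<circ> \<sigma>\<^sub>2) H\<^sub>2 = \<sigma>\<^sub>2"
  "restrict_id (\<alpha>\<^sub>1 \<circ> \<alpha>\<^sub>2) H\<^sub>1 = \<alpha>\<^sub>1" "restrict_id (\<alpha>\<^sub>1 \<circ> \<alpha>\<^sub>2) H\<^sub>2 = \<alpha>\<^sub>2"
  using not_in_both
  by (auto simp: restrict_id_def fun_eq_iff M\<^sub>1.\<sigma>_outside M\<^sub>2.\<sigma>_outside M\<^sub>1.\<alpha>_outside M\<^sub>2.\<alpha>_outside)

end

section \<open>Splitting\<close>

locale splitting = bridgeless_map +
  fixes S :: "'a set" and u :: 'a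
  assumes root_side: "root_side S u"
begin

definition "x = \<sigma> r"
definition "v = \<alpha> u"
definition "i = (if \<sigma> x = u then r else inv \<sigma> u)"
definition "H\<^sub>1 = S - {u}"
definition "H\<^sub>2 = H - S"
definition "\<tau> = \<sigma> \<circ> transpose v x \<circ> transpose r v \<circ> transpose i u"
definition "\<beta> = \<alpha> \<circ> transpose u v"

lemma S_subset: "S \<subseteq> H" and r_in_S: "r \<in> S" and x_notin_S: "x \<notin> S"
  and invariant_insert_x: "invariant \<sigma> (insert x S)" and exits_S: "exits \<alpha> S = {u}"
  using root_side by (auto simp: root_side_def x_def)

lemma u_in_S: "u \<in> S" and v_notin_S: "v \<notin> S"
  using exits_S by (auto simp: exits_def v_def)

lemma \<alpha>_in_S: "h \<in> S \<Longrightarrow> h \<noteq> u \<Longrightarrow> \<alpha> h \<in> S"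
  using exits_S by (auto simp: exits_def)

lemma \<alpha>_neq_u: "h \<in> S \<Longrightarrow> \<alpha> h \<noteq> u"
  using v_notin_S unfolding v_def by (metis \<alpha>_\<alpha>)

lemma u_neq_r [simp]: "u \<noteq> r" "r \<noteq> u"
  using \<alpha>_neq_u[OF r_in_S] by auto

lemma x_v_in_H\<^sub>2 [simp]: "x \<in> H\<^sub>2" "v \<in> H\<^sub>2"
  using S_subset u_in_S x_notin_S v_notin_S by (auto simp: H\<^sub>2_def x_def v_def)

lemma in_H_iff: "h \<in> H \<longleftrightarrow> h = u \<or> h \<in> H\<^sub>1 \<or> h \<in> H\<^sub>2" and H\<^sub>1_H\<^sub>2_disjoint: "H\<^sub>1 \<inter> H\<^sub>2 = {}"
  and u_notin_parts [simp]: "u \<notin> H\<^sub>1" "u \<notin> H\<^sub>2"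
  using S_subset u_in_S by (auto simp: H\<^sub>1_def H\<^sub>2_def)

lemma finite_parts: "finite H\<^sub>1" "finite H\<^sub>2"
  using finite_subset[OF _ finite_H] S_subset by (auto simp: H\<^sub>1_def H\<^sub>2_def)

lemma r_in_H\<^sub>1 [simp]: "r \<in> H\<^sub>1"
  using r_in_S by (simp add: H\<^sub>1_def)

lemma \<sigma>_u_neq_u: "\<sigma> u \<noteq> u"
proof
  assume "\<sigma> u = u"
  then have "invariant \<sigma> {u}" using u_in_S S_subset by (intro invariant_\<sigma>I) auto
  then have "{u} = {}" using u_in_S S_subset by (intro cut_condition[of _ u]) (auto simp: exits_def)
  then show False by simp
qed

lemma \<sigma>_i: "i \<noteq> r \<Longrightarrow> \<sigma> i = u"
  unfolding i_def using permutes_inverses(1)[OF \<sigma>_permutes] by auto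

lemma \<sigma>_x: "i = r \<Longrightarrow> \<sigma> x = u"
  using permutes_inverses(1)[OF \<sigma>_permutes, of u] u_in_S x_notin_S
  unfolding i_def by (auto simp: x_def split: if_splits)

lemma i_in_H\<^sub>1 [simp]: "i \<in> H\<^sub>1"
proof (cases "\<sigma> x = u")
  case False
  then have "\<sigma> i = u" unfolding i_def using permutes_inverses(1)[OF \<sigma>_permutes] by auto
  moreover from this have "i \<noteq> x" "i \<noteq> u" using False \<sigma>_u_neq_u by auto
  ultimately show ?thesis
    using invariantD[OF invariant_insert_x, of i] u_in_S by (simp add: H\<^sub>1_def)
qed (simp add: i_def)

lemma notin_other_side [simp]: "r \<notin> H\<^sub>2" "i \<notin> H\<^sub>2" "v \<notin> H\<^sub>1" "x \<notin> H\<^sub>1"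
  using H\<^sub>1_H\<^sub>2_disjoint r_in_H\<^sub>1 i_in_H\<^sub>1 x_v_in_H\<^sub>2 by blast+

lemma neqs [simp]:
  "u \<noteq> v" "u \<noteq> x" "u \<noteq> i" "r \<noteq> v" "r \<noteq> x" "i \<noteq> v" "i \<noteq> x"
  "v \<noteq> u" "x \<noteq> u" "i \<noteq> u" "v \<noteq> r" "x \<noteq> r" "v \<noteq> i" "x \<noteq> i"
  using notin_other_side i_in_H\<^sub>1 r_in_H\<^sub>1 x_v_in_H\<^sub>2 u_notin_parts by metis+

lemma \<tau>_u: "\<tau> u = u"
  using \<sigma>_x \<sigma>_i by (cases "i = r") (simp_all add: \<tau>_def transpose_def)

lemma \<tau>_v: "\<tau> v = x"
  by (simp add: \<tau>_def transpose_def) (simp add: x_def)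

lemma \<tau>_i: "\<tau> i = \<sigma> u"
  by (simp add: \<tau>_def transpose_def)

lemma \<tau>_r: "i \<noteq> r \<Longrightarrow> \<tau> r = \<sigma> x"
  by (simp add: \<tau>_def transpose_def)

lemma \<tau>_eq_\<sigma>:
  "h \<in> H\<^sub>1 \<Longrightarrow> h \<noteq> i \<Longrightarrow> h \<noteq> r \<Longrightarrow> \<tau> h = \<sigma> h" "h \<in> H\<^sub>2 \<Longrightarrow> h \<noteq> v \<Longrightarrow> h \<noteq> x \<Longrightarrow> \<tau> h = \<sigma> h"
  by (auto simp: \<tau>_def transpose_def)

lemma \<tau>_permutes: "\<tau> permutes H\<^sub>1 \<union> H\<^sub>2"
proof (rule permutes_superset)
  have "transpose v x permutes H" "transpose r v permutes H" "transpose i u permutes H"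
    by (auto intro: permutes_swap_id simp: in_H_iff)
  then show "\<tau> permutes H" unfolding \<tau>_def using \<sigma>_permutes by (simp add: permutes_compose)
  show "\<tau> h = h" if "h \<in> H - (H\<^sub>1 \<union> H\<^sub>2)" for h using that \<tau>_u by (auto simp: in_H_iff)
qed

lemma \<tau>_eq_iff: "\<tau> g = \<tau> h \<longleftrightarrow> g = h"
  using permutes_inj[OF \<tau>_permutes] by (rule inj_eq)

lemma \<tau>_H\<^sub>1: "invariant \<tau> H\<^sub>1"
proof (rule finite_invariantI)
  show "finite H\<^sub>1" by (rule finite_parts(1))
  show "inj \<tau>" using \<tau>_permutes by (rule permutes_inj)
  fix h assume h: "h \<in> H\<^sub>1"
  have "\<tau> h \<noteq> u" using h \<tau>_eq_iff[of h u] \<tau>_u by auto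
  moreover have "\<tau> h \<in> S"
  proof -
    have \<sigma>_in_S: "\<sigma> g \<in> S" if "g \<in> insert x S" "g \<noteq> r" for g
      using that invariantD[OF invariant_insert_x, of g] \<sigma>_eq_iff[of g r] by (auto simp: x_def)
    have "h \<in> S" using h by (simp add: H\<^sub>1_def)
    consider "h = i" | "h = r" "i \<noteq> r" | "h \<noteq> i" "h \<noteq> r" by metis
    then show ?thesis
      by cases (use h u_in_S \<open>h \<in> S\<close> in \<open>simp_all add: \<tau>_i \<tau>_r \<tau>_eq_\<sigma> \<sigma>_in_S\<close>)
  qed
  ultimately show "\<tau> h \<in> H\<^sub>1" by (simp add: H\<^sub>1_def)
qed

lemma \<beta>_u: "\<beta> u = u" and \<beta>_v: "\<beta> v = v"
  by (simp_all add: \<beta>_def v_def)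

lemma \<beta>_other: "h \<noteq> u \<Longrightarrow> h \<noteq> v \<Longrightarrow> \<beta> h = \<alpha> h"
  by (simp add: \<beta>_def)

lemma \<beta>_\<beta>: "\<beta> (\<beta> h) = h"
proof -
  have "\<alpha> v = u" by (simp add: v_def)
  consider "h = u" | "h = v" | "h \<noteq> u" "h \<noteq> v" by blast
  then show ?thesis
  proof cases
    case 3
    then have "\<alpha> h \<noteq> v" "\<alpha> h \<noteq> u" using \<open>\<alpha> v = u\<close> \<alpha>_\<alpha>[of h] by (auto simp: v_def)
    then show ?thesis using 3 by (simp add: \<beta>_other)
  qed (simp_all add: \<beta>_u \<beta>_v)
qed

lemma \<beta>_permutes: "\<beta> permutes H\<^sub>1 \<union> H\<^sub>2"
proof (rule permutes_superset)
  have "transpose u v permutes H" by (auto intro: permutes_swap_id simp: in_H_iff)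
  then show "\<beta> permutes H" unfolding \<beta>_def using \<alpha>_permutes by (simp add: permutes_compose)
  show "\<beta> h = h" if "h \<in> H - (H\<^sub>1 \<union> H\<^sub>2)" for h using that \<beta>_u by (auto simp: in_H_iff)
qed

lemma \<beta>_H\<^sub>1: "invariant \<beta> H\<^sub>1"
proof -
  have "\<beta> h \<in> H\<^sub>1" if "h \<in> H\<^sub>1" for h
  proof -
    have "h \<noteq> u" "h \<noteq> v" using that v_notin_S by (auto simp: H\<^sub>1_def)
    then show ?thesis using that \<alpha>_in_S[of h] \<alpha>_neq_u[of h] by (simp add: \<beta>_other H\<^sub>1_def)
  qed
  then show ?thesis
    using finite_parts(1) permutes_inj[OF \<beta>_permutes] by (intro finite_invariantI)
qed

definition "\<sigma>\<^sub>1 = restrict_id \<tau> H\<^sub>1"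
definition "\<sigma>\<^sub>2 = restrict_id \<tau> H\<^sub>2"
definition "\<alpha>\<^sub>1 = restrict_id \<beta> H\<^sub>1"
definition "\<alpha>\<^sub>2 = restrict_id \<beta> H\<^sub>2"

lemmas \<tau>_parts =
  permutes_Un_restrict_id[OF \<tau>_permutes H\<^sub>1_H\<^sub>2_disjoint \<tau>_H\<^sub>1, folded \<sigma>\<^sub>1_def \<sigma>\<^sub>2_def]
lemmas \<beta>_parts =
  permutes_Un_restrict_id[OF \<beta>_permutes H\<^sub>1_H\<^sub>2_disjoint \<beta>_H\<^sub>1, folded \<alpha>\<^sub>1_def \<alpha>\<^sub>2_def]

lemma restrict_id_\<beta>_involution:
  assumes "restrict_id \<beta> A permutes A"
  shows "restrict_id \<beta> A (restrict_id \<beta> A h) = h"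
  using permutes_in_image[OF assms, of h] \<beta>_\<beta>[of h] by (cases "h \<in> A") auto

sublocale parts: gluing H\<^sub>1 \<sigma>\<^sub>1 \<alpha>\<^sub>1 r H\<^sub>2 \<sigma>\<^sub>2 \<alpha>\<^sub>2 v i u
proof
  show "finite H\<^sub>1" "finite H\<^sub>2" by (fact finite_parts)+
  show "\<alpha>\<^sub>1 (\<alpha>\<^sub>1 h) = h" "\<alpha>\<^sub>2 (\<alpha>\<^sub>2 h) = h" for h
    using \<beta>_parts(1,2) restrict_id_\<beta>_involution by (simp_all add: \<alpha>\<^sub>1_def \<alpha>\<^sub>2_def)
  show "\<alpha>\<^sub>1 h = h \<longleftrightarrow> h = r" if "h \<in> H\<^sub>1" for h
  proof -
    have "h \<in> H" "h \<noteq> u" "h \<noteq> v" using that v_notin_S by (auto simp: in_H_iff H\<^sub>1_def)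
    then show ?thesis using that \<alpha>_fixed_iff by (simp add: \<alpha>\<^sub>1_def \<beta>_other)
  qed
  show "\<alpha>\<^sub>2 h = h \<longleftrightarrow> h = v" if "h \<in> H\<^sub>2" for h
  proof (cases "h = v")
    case False
    then have "h \<in> H" "h \<noteq> u" "h \<noteq> r" using that r_in_S u_in_S by (auto simp: H\<^sub>2_def)
    then show ?thesis using that False \<alpha>_fixed_iff by (simp add: \<alpha>\<^sub>2_def \<beta>_other)
  qed (simp add: \<alpha>\<^sub>2_def \<beta>_v)
qed (use \<tau>_parts(1,2) \<beta>_parts(1,2) H\<^sub>1_H\<^sub>2_disjoint in auto)

lemma glue_parts: "glue u i (\<sigma>\<^sub>1, \<alpha>\<^sub>1, r) (\<sigma>\<^sub>2, \<alpha>\<^sub>2, v) = (\<sigma>, \<alpha>, r)"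
proof -
  have "\<sigma>\<^sub>2 v = x" by (simp add: \<sigma>\<^sub>2_def \<tau>_v)
  then show ?thesis
    unfolding glue_def prod.case \<tau>_parts(3) \<beta>_parts(3)
    by (simp add: \<tau>_def \<beta>_def fun_eq_iff)
qed

lemma exits_S_Diff:
  assumes "T \<subseteq> H\<^sub>1"
  shows "exits \<alpha> (S - insert u T) = \<alpha> ` exits \<alpha> T"
proof (intro equalityI subsetI)
  fix h assume h: "h \<in> exits \<alpha> (S - insert u T)"
  then have "\<alpha> h \<in> exits \<alpha> T" using \<alpha>_in_S[of h] \<alpha>_neq_u[of h] by (auto simp: exits_def)
  then show "h \<in> \<alpha> ` exits \<alpha> T" by (rule rev_image_eqI) simp
next
  fix h assume "h \<in> \<alpha> ` exits \<alpha> T"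
  then obtain k where k: "h = \<alpha> k" "k \<in> T" "\<alpha> k \<notin> T" by (auto simp: exits_def)
  then have "k \<in> S" "k \<noteq> u" using assms by (auto simp: H\<^sub>1_def)
  then show "h \<in> exits \<alpha> (S - insert u T)"
    using k \<alpha>_in_S[of k] \<alpha>_neq_u[of k] by (simp add: exits_def)
qed

lemma cut_off_single_exit:
  assumes T: "T \<subseteq> H\<^sub>1" "r \<notin> T" and invariant: "invariant \<sigma> (insert u T)"
    and exits: "exits \<alpha> T \<subseteq> {a}"
  shows "root_side (S - insert u T) (\<alpha> a)"
proof -
  have "T \<subseteq> H" using T(1) by (auto simp: in_H_iff)
  have "exits \<alpha> T \<noteq> {}"
  proof
    assume "exits \<alpha> T = {}"
    then have "exits \<alpha> (insert u T) \<subseteq> {u}" by (auto simp: exits_def)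
    then have "insert u T = {}"
      using invariant \<open>T \<subseteq> H\<close> T(2) by (intro cut_condition) (auto simp: in_H_iff)
    then show False by simp
  qed
  then have "exits \<alpha> (S - insert u T) = {\<alpha> a}"
    using exits unfolding exits_S_Diff[OF T(1)] by auto
  moreover have "x \<notin> T" using T(1) notin_other_side(4) by blast
  then have "insert x (S - insert u T) = insert x S - insert u T" by auto
  then have "invariant \<sigma> (insert x (S - insert u T))"
    using invariant invariant_insert_x by (simp add: invariant_def)
  ultimately show ?thesis
    unfolding root_side_def x_def[symmetric]
    using S_subset r_in_S T(2) x_notin_S by auto
qed

lemma bridgeless_part\<^sub>1:
  assumes minimal: "\<And>S' u'. root_side S' u' \<Longrightarrow> \<not> S' \<subset> S"
  shows "bridgeless_map H\<^sub>1 \<sigma>\<^sub>1 \<alpha>\<^sub>1 r"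
proof unfold_locales
  fix T a assume T: "T \<subseteq> H\<^sub>1" "r \<notin> T" "invariant \<sigma>\<^sub>1 T" "exits \<alpha>\<^sub>1 T \<subseteq> {a}"
  have T_notin: "u \<notin> T" "v \<notin> T" using T(1) notin_other_side(3) u_notin_parts(1) by auto
  have "\<alpha> h = \<alpha>\<^sub>1 h" if "h \<in> T" for h
    using that T(1) T_notin by (subst \<beta>_other[symmetric]) (auto simp: \<alpha>\<^sub>1_def)
  then have exits_T: "exits \<alpha> T \<subseteq> {a}" using T(4) by (simp add: exits_def cong: conj_cong)
  have \<tau>_T: "\<tau> h \<in> T" if "h \<in> T" for h
    using that T(1) invariantD[OF T(3), of h] by (auto simp: \<sigma>\<^sub>1_def)
  have \<sigma>_T: "\<sigma> h \<in> T" if "h \<in> T" "h \<noteq> i" for h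
    using \<tau>_T[OF that(1)] \<tau>_eq_\<sigma>(1)[of h] that T(1,2) by (metis subsetD)
  have "T \<subseteq> H" using T(1) by (auto simp: in_H_iff)
  show "T = {}"
  proof (cases "i \<in> T")
    case False
    then have "invariant \<sigma> T" using \<sigma>_T \<open>T \<subseteq> H\<close> by (intro invariant_\<sigma>I) auto
    then show ?thesis using \<open>T \<subseteq> H\<close> T(2) exits_T by (intro cut_condition)
  next
    case True
    have "\<sigma> h \<in> insert u T" if "h \<in> insert u T" for h
    proof -
      have "i \<noteq> r" using True T(2) by auto
      then show ?thesis using that \<sigma>_T \<sigma>_i \<tau>_T[OF True] \<tau>_i by (cases "h = i") auto
    qed
    then have "invariant \<sigma> (insert u T)"
      using \<open>T \<subseteq> H\<close> by (intro invariant_\<sigma>I) (auto simp: in_H_iff)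
    then have "root_side (S - insert u T) (\<alpha> a)"
      using T(1,2) exits_T by (intro cut_off_single_exit)
    moreover have "S - insert u T \<subset> S" using u_in_S by auto
    ultimately show ?thesis using minimal by blast
  qed
qed

lemma bridgeless_part\<^sub>2: "bridgeless_map H\<^sub>2 \<sigma>\<^sub>2 \<alpha>\<^sub>2 v"
proof unfold_locales
  fix T a assume T: "T \<subseteq> H\<^sub>2" "v \<notin> T" "invariant \<sigma>\<^sub>2 T" "exits \<alpha>\<^sub>2 T \<subseteq> {a}"
  have "x \<notin> T" using T(2) invariantD[OF T(3), of v] \<tau>_v by (simp add: \<sigma>\<^sub>2_def)
  then have T_in: "h \<in> H\<^sub>2 \<and> h \<noteq> v \<and> h \<noteq> x" if "h \<in> T" for h using that T(1,2) by auto
  have "\<sigma> h \<in> T" if "h \<in> T" for h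
    using that T_in[OF that] invariantD[OF T(3), of h] \<tau>_eq_\<sigma>(2)[of h] by (simp add: \<sigma>\<^sub>2_def)
  moreover have "T \<subseteq> H" using T(1) by (auto simp: in_H_iff)
  ultimately have "invariant \<sigma> T" by (intro invariant_\<sigma>I)
  moreover have "\<alpha> h = \<alpha>\<^sub>2 h" if "h \<in> T" for h
    using that T_in[OF that] by (subst \<beta>_other[symmetric]) (auto simp: \<alpha>\<^sub>2_def)
  then have "exits \<alpha> T \<subseteq> {a}" using T(4) by (simp add: exits_def cong: conj_cong)
  ultimately show "T = {}" using \<open>T \<subseteq> H\<close> T_in[of r] by (intro cut_condition) auto
qed

end

section \<open>Counting maps\<close>

definition glue_data :: "'a set \<Rightarrow> ('a \<times> 'a set \<times> 'a rmap \<times> 'a \<times> 'a rmap) set" where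
  "glue_data H = (SIGMA u:H. SIGMA H\<^sub>1:Pow (H - {u}).
     bridgeless_maps_on H\<^sub>1 \<times> H\<^sub>1 \<times> bridgeless_maps_on (H - {u} - H\<^sub>1))"

lemma glue_dataE:
  assumes "d \<in> glue_data H"
  obtains u H\<^sub>1 \<sigma>\<^sub>1 \<alpha>\<^sub>1 r\<^sub>1 i H\<^sub>2 \<sigma>\<^sub>2 \<alpha>\<^sub>2 r\<^sub>2
  where "d = (u, H\<^sub>1, (\<sigma>\<^sub>1, \<alpha>\<^sub>1, r\<^sub>1), i, (\<sigma>\<^sub>2, \<alpha>\<^sub>2, r\<^sub>2))"
    "gluing H\<^sub>1 \<sigma>\<^sub>1 \<alpha>\<^sub>1 r\<^sub>1 H\<^sub>2 \<sigma>\<^sub>2 \<alpha>\<^sub>2 r\<^sub>2 i u"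
    "bridgeless_map H\<^sub>1 \<sigma>\<^sub>1 \<alpha>\<^sub>1 r\<^sub>1" "bridgeless_map H\<^sub>2 \<sigma>\<^sub>2 \<alpha>\<^sub>2 r\<^sub>2" "gluing.H H\<^sub>1 H\<^sub>2 u = H"
proof -
  obtain u H\<^sub>1 M\<^sub>1 i M\<^sub>2 where "d = (u, H\<^sub>1, M\<^sub>1, i, M\<^sub>2)" by (cases d)
  moreover obtain \<sigma>\<^sub>1 \<alpha>\<^sub>1 r\<^sub>1 where "M\<^sub>1 = (\<sigma>\<^sub>1, \<alpha>\<^sub>1, r\<^sub>1)" by (cases M\<^sub>1)
  moreover obtain \<sigma>\<^sub>2 \<alpha>\<^sub>2 r\<^sub>2 where "M\<^sub>2 = (\<sigma>\<^sub>2, \<alpha>\<^sub>2, r\<^sub>2)" by (cases M\<^sub>2)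
  ultimately have d: "d = (u, H\<^sub>1, (\<sigma>\<^sub>1, \<alpha>\<^sub>1, r\<^sub>1), i, (\<sigma>\<^sub>2, \<alpha>\<^sub>2, r\<^sub>2))" by simp
  then have data: "u \<in> H" "H\<^sub>1 \<subseteq> H - {u}" "i \<in> H\<^sub>1" "bridgeless_map H\<^sub>1 \<sigma>\<^sub>1 \<alpha>\<^sub>1 r\<^sub>1"
    "bridgeless_map (H - {u} - H\<^sub>1) \<sigma>\<^sub>2 \<alpha>\<^sub>2 r\<^sub>2"
    using assms by (auto simp: glue_data_def)
  then have gluing: "gluing H\<^sub>1 \<sigma>\<^sub>1 \<alpha>\<^sub>1 r\<^sub>1 (H - {u} - H\<^sub>1) \<sigma>\<^sub>2 \<alpha>\<^sub>2 r\<^sub>2 i u"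
    by (auto simp: gluing_def gluing_axioms_def bridgeless_map_def)
  moreover have "gluing.H H\<^sub>1 (H - {u} - H\<^sub>1) u = H"
    using data(1,2) by (auto simp: gluing.H_def[OF gluing])
  ultimately show thesis using that[OF d] data(4,5) by blast
qed

lemma (in gluing) in_glue_data:
  assumes "bridgeless_map H\<^sub>1 \<sigma>\<^sub>1 \<alpha>\<^sub>1 r\<^sub>1" and "bridgeless_map H\<^sub>2 \<sigma>\<^sub>2 \<alpha>\<^sub>2 r\<^sub>2"
  shows "(u, H\<^sub>1, (\<sigma>\<^sub>1, \<alpha>\<^sub>1, r\<^sub>1), i, (\<sigma>\<^sub>2, \<alpha>\<^sub>2, r\<^sub>2)) \<in> glue_data H"
proof -
  have "H - {u} - H\<^sub>1 = H\<^sub>2" using disjoint u_notin by (auto simp: H_def)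
  moreover have "u \<in> H" "H\<^sub>1 \<subseteq> H - {u}" by (auto simp: H_def)
  ultimately show ?thesis using assms by (simp add: glue_data_def)
qed

lemma glue_inject:
  assumes A: "gluing H\<^sub>1 \<sigma>\<^sub>1 \<alpha>\<^sub>1 r\<^sub>1 H\<^sub>2 \<sigma>\<^sub>2 \<alpha>\<^sub>2 r\<^sub>2 i u" "bridgeless_map H\<^sub>1 \<sigma>\<^sub>1 \<alpha>\<^sub>1 r\<^sub>1"
    and B: "gluing H\<^sub>1' \<sigma>\<^sub>1' \<alpha>\<^sub>1' r\<^sub>1' H\<^sub>2' \<sigma>\<^sub>2' \<alpha>\<^sub>2' r\<^sub>2' i' u'"
      "bridgeless_map H\<^sub>1' \<sigma>\<^sub>1' \<alpha>\<^sub>1' r\<^sub>1'"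
    and H: "gluing.H H\<^sub>1 H\<^sub>2 u = gluing.H H\<^sub>1' H\<^sub>2' u'"
    and glue: "glue u i (\<sigma>\<^sub>1, \<alpha>\<^sub>1, r\<^sub>1) (\<sigma>\<^sub>2, \<alpha>\<^sub>2, r\<^sub>2) =
      glue u' i' (\<sigma>\<^sub>1', \<alpha>\<^sub>1', r\<^sub>1') (\<sigma>\<^sub>2', \<alpha>\<^sub>2', r\<^sub>2')"
  shows "(u, H\<^sub>1, (\<sigma>\<^sub>1, \<alpha>\<^sub>1, r\<^sub>1), i, (\<sigma>\<^sub>2, \<alpha>\<^sub>2, r\<^sub>2)) =
    (u', H\<^sub>1', (\<sigma>\<^sub>1', \<alpha>\<^sub>1', r\<^sub>1'), i', (\<sigma>\<^sub>2', \<alpha>\<^sub>2', r\<^sub>2'))"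
proof -
  interpret A: gluing H\<^sub>1 \<sigma>\<^sub>1 \<alpha>\<^sub>1 r\<^sub>1 H\<^sub>2 \<sigma>\<^sub>2 \<alpha>\<^sub>2 r\<^sub>2 i u by fact
  interpret B: gluing H\<^sub>1' \<sigma>\<^sub>1' \<alpha>\<^sub>1' r\<^sub>1' H\<^sub>2' \<sigma>\<^sub>2' \<alpha>\<^sub>2' r\<^sub>2' i' u' by fact
  have eq: "A.\<sigma> = B.\<sigma>" "A.\<alpha> = B.\<alpha>" "r\<^sub>1 = r\<^sub>1'"
    using glue unfolding A.glue_eq B.glue_eq prod.inject by blast+
  then have "A.glued.root_side = B.glued.root_side" using H by metis
  then have S: "insert u H\<^sub>1 = insert u' H\<^sub>1'"
    using A.root_side_least[OF A(2)] A.root_side_glued B.root_side_least[OF B(2)] B.root_side_glued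
    by (metis subset_antisym)
  have "exits A.\<alpha> (insert u H\<^sub>1) = {u}" "exits B.\<alpha> (insert u' H\<^sub>1') = {u'}"
    using A.root_side_glued B.root_side_glued
    unfolding A.glued.root_side_def B.glued.root_side_def by blast+
  then have u: "u = u'" using S eq(2) by simp
  have H\<^sub>1: "H\<^sub>1 = H\<^sub>1'" using S A.u_notin B.u_notin unfolding u by (simp add: insert_ident)
  have "insert u (H\<^sub>1 \<union> H\<^sub>2) = insert u' (H\<^sub>1' \<union> H\<^sub>2')" using H by (simp only: A.H_def B.H_def)
  then have "H\<^sub>1 \<union> H\<^sub>2 = H\<^sub>1' \<union> H\<^sub>2'"
    using A.u_notin B.u_notin unfolding u by (simp add: insert_ident)
  then have H\<^sub>2: "H\<^sub>2 = H\<^sub>2'" using A.disjoint B.disjoint unfolding H\<^sub>1 by blast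
  have r\<^sub>2: "r\<^sub>2 = r\<^sub>2'" using A.\<alpha>_u B.\<alpha>_u eq u by metis
  have x: "A.x = B.x" using A.\<sigma>_r\<^sub>1 B.\<sigma>_r\<^sub>1 eq by metis
  have i: "i = i'" using A.i_eq B.i_eq eq u x by metis
  have "\<sigma>\<^sub>1 \<circ> \<sigma>\<^sub>2 = \<sigma>\<^sub>1' \<circ> \<sigma>\<^sub>2'"
    unfolding A.\<sigma>\<^sub>1_\<sigma>\<^sub>2_eq B.\<sigma>\<^sub>1_\<sigma>\<^sub>2_eq eq(1) x using eq(3) r\<^sub>2 i u by simp
  moreover have "\<alpha>\<^sub>1 \<circ> \<alpha>\<^sub>2 = \<alpha>\<^sub>1' \<circ> \<alpha>\<^sub>2'"
    unfolding A.\<alpha>\<^sub>1_\<alpha>\<^sub>2_eq B.\<alpha>\<^sub>1_\<alpha>\<^sub>2_eq eq(2) using r\<^sub>2 u by simp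
  ultimately have "\<sigma>\<^sub>1 = \<sigma>\<^sub>1'" "\<sigma>\<^sub>2 = \<sigma>\<^sub>2'" "\<alpha>\<^sub>1 = \<alpha>\<^sub>1'" "\<alpha>\<^sub>2 = \<alpha>\<^sub>2'"
    using A.restrict_id_parts B.restrict_id_parts H\<^sub>1 H\<^sub>2 by metis+
  then show ?thesis using u H\<^sub>1 i r\<^sub>2 eq(3) by simp
qed

lemma (in bridgeless_map) root_side_exists:
  assumes "H \<noteq> {r}"
  shows "root_side (H - {\<sigma> r}) (\<alpha> (\<sigma> r))"
proof -
  have "\<sigma> r \<noteq> r"
  proof
    assume "\<sigma> r = r"
    have "H - {r} = {}"
    proof (rule cut_condition)
      show "invariant \<sigma> (H - {r})"
        using \<sigma>_eq_iff[of _ r] \<open>\<sigma> r = r\<close> by (intro invariant_\<sigma>I) auto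
      show "exits \<alpha> (H - {r}) \<subseteq> {r}" by (auto simp: exits_def)
    qed auto
    then show False using assms root_in by blast
  qed
  then have "\<alpha> (\<sigma> r) \<noteq> \<sigma> r" by (simp add: \<alpha>_fixed_iff)
  have "exits \<alpha> (H - {\<sigma> r}) = {\<alpha> (\<sigma> r)}"
  proof (intro equalityI subsetI)
    fix h assume "h \<in> exits \<alpha> (H - {\<sigma> r})"
    then have "\<sigma> r = \<alpha> h" by (auto simp: exits_def)
    then show "h \<in> {\<alpha> (\<sigma> r)}" by simp
  next
    fix h assume "h \<in> {\<alpha> (\<sigma> r)}"
    then show "h \<in> exits \<alpha> (H - {\<sigma> r})" using \<open>\<alpha> (\<sigma> r) \<noteq> \<sigma> r\<close> by (simp add: exits_def)
  qed
  moreover have "insert (\<sigma> r) (H - {\<sigma> r}) = H" by (rule insert_Diff) simp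
  ultimately show ?thesis using \<open>\<sigma> r \<noteq> r\<close> by (auto simp: root_side_def invariant_def)
qed

lemma (in bridgeless_map) minimal_root_side:
  assumes "H \<noteq> {r}"
  obtains S u where "root_side S u" "\<And>S' u'. root_side S' u' \<Longrightarrow> \<not> S' \<subset> S"
proof -
  let ?sides = "{S. \<exists>u. root_side S u}"
  have "?sides \<subseteq> Pow H" unfolding root_side_def by blast
  then have "finite ?sides" by (rule finite_subset) (simp add: finite_H)
  moreover have "?sides \<noteq> {}" using root_side_exists[OF assms] by blast
  ultimately obtain S where S: "S \<in> ?sides" "\<forall>S'\<in>?sides. S' \<subseteq> S \<longrightarrow> S = S'"
    by (rule finite_has_minimal[THEN bexE])
  then obtain u where "root_side S u" by blast
  moreover have "\<not> S' \<subset> S" if "root_side S' u'" for S' u' using S(2) that by blast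
  ultimately show thesis by (rule that)
qed

lemma (in bridgeless_map) eq_glue:
  assumes "H \<noteq> {r}"
  shows "\<exists>(u, H\<^sub>1, M\<^sub>1, i, M\<^sub>2)\<in>glue_data H. (\<sigma>, \<alpha>, r) = glue u i M\<^sub>1 M\<^sub>2"
proof -
  obtain S u where S: "root_side S u" and minimal: "\<And>S' u'. root_side S' u' \<Longrightarrow> \<not> S' \<subset> S"
    using assms minimal_root_side by blast
  interpret splitting H \<sigma> \<alpha> r S u by unfold_locales (rule S)
  have "(u, H\<^sub>1, (\<sigma>\<^sub>1, \<alpha>\<^sub>1, r), i, (\<sigma>\<^sub>2, \<alpha>\<^sub>2, v)) \<in> glue_data parts.H"
    using bridgeless_part\<^sub>1[OF minimal] bridgeless_part\<^sub>2 by (rule parts.in_glue_data)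
  moreover have "parts.H = H" by (auto simp: parts.H_def in_H_iff)
  ultimately show ?thesis using glue_parts[symmetric] by (intro bexI) auto
qed

lemma bij_betw_glue:
  assumes "card H \<noteq> 1"
  shows "bij_betw (\<lambda>(u, H\<^sub>1, M\<^sub>1, i, M\<^sub>2). glue u i M\<^sub>1 M\<^sub>2) (glue_data H) (bridgeless_maps_on H)"
proof (rule bij_betw_imageI)
  let ?glue = "\<lambda>(u, H\<^sub>1 :: 'a set, M\<^sub>1, i, M\<^sub>2). glue u i M\<^sub>1 M\<^sub>2"
  show "inj_on ?glue (glue_data H)"
  proof (rule inj_onI)
    fix d d' assume d: "d \<in> glue_data H" and d': "d' \<in> glue_data H" and eq: "?glue d = ?glue d'"
    obtain u H\<^sub>1 \<sigma>\<^sub>1 \<alpha>\<^sub>1 r\<^sub>1 i H\<^sub>2 \<sigma>\<^sub>2 \<alpha>\<^sub>2 r\<^sub>2 where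
      A: "d = (u, H\<^sub>1, (\<sigma>\<^sub>1, \<alpha>\<^sub>1, r\<^sub>1), i, (\<sigma>\<^sub>2, \<alpha>\<^sub>2, r\<^sub>2))"
        "gluing H\<^sub>1 \<sigma>\<^sub>1 \<alpha>\<^sub>1 r\<^sub>1 H\<^sub>2 \<sigma>\<^sub>2 \<alpha>\<^sub>2 r\<^sub>2 i u"
        "bridgeless_map H\<^sub>1 \<sigma>\<^sub>1 \<alpha>\<^sub>1 r\<^sub>1" "gluing.H H\<^sub>1 H\<^sub>2 u = H"
      using d by (rule glue_dataE)
    obtain u' H\<^sub>1' \<sigma>\<^sub>1' \<alpha>\<^sub>1' r\<^sub>1' i' H\<^sub>2' \<sigma>\<^sub>2' \<alpha>\<^sub>2' r\<^sub>2' where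
      B: "d' = (u', H\<^sub>1', (\<sigma>\<^sub>1', \<alpha>\<^sub>1', r\<^sub>1'), i', (\<sigma>\<^sub>2', \<alpha>\<^sub>2', r\<^sub>2'))"
        "gluing H\<^sub>1' \<sigma>\<^sub>1' \<alpha>\<^sub>1' r\<^sub>1' H\<^sub>2' \<sigma>\<^sub>2' \<alpha>\<^sub>2' r\<^sub>2' i' u'"
        "bridgeless_map H\<^sub>1' \<sigma>\<^sub>1' \<alpha>\<^sub>1' r\<^sub>1'" "gluing.H H\<^sub>1' H\<^sub>2' u' = H"
      using d' by (rule glue_dataE)
    show "d = d'"
      unfolding A(1) B(1)
      by (rule glue_inject[OF A(2,3) B(2,3)]) (use A(1,4) B(1,4) eq in simp_all)
  qed
  show "?glue ` glue_data H = bridgeless_maps_on H"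
  proof (intro equalityI subsetI)
    fix M assume "M \<in> ?glue ` glue_data H"
    then obtain d where d: "d \<in> glue_data H" and M: "M = ?glue d" by blast
    obtain u H\<^sub>1 \<sigma>\<^sub>1 \<alpha>\<^sub>1 r\<^sub>1 i H\<^sub>2 \<sigma>\<^sub>2 \<alpha>\<^sub>2 r\<^sub>2 where
      A: "d = (u, H\<^sub>1, (\<sigma>\<^sub>1, \<alpha>\<^sub>1, r\<^sub>1), i, (\<sigma>\<^sub>2, \<alpha>\<^sub>2, r\<^sub>2))"
        "gluing H\<^sub>1 \<sigma>\<^sub>1 \<alpha>\<^sub>1 r\<^sub>1 H\<^sub>2 \<sigma>\<^sub>2 \<alpha>\<^sub>2 r\<^sub>2 i u"
        "bridgeless_map H\<^sub>1 \<sigma>\<^sub>1 \<alpha>\<^sub>1 r\<^sub>1" "bridgeless_map H\<^sub>2 \<sigma>\<^sub>2 \<alpha>\<^sub>2 r\<^sub>2" "gluing.H H\<^sub>1 H\<^sub>2 u = H"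
      using d by (rule glue_dataE)
    show "M \<in> bridgeless_maps_on H"
      using gluing.bridgeless_glued[OF A(2-4)] A(5) by (simp add: M A(1) gluing.glue_eq[OF A(2)])
  next
    fix M assume M: "M \<in> bridgeless_maps_on H"
    obtain \<sigma> \<alpha> r where "M = (\<sigma>, \<alpha>, r)" by (cases M)
    moreover from this interpret bridgeless_map H \<sigma> \<alpha> r using M by simp
    have "H \<noteq> {r}" using assms by auto
    ultimately show "M \<in> ?glue ` glue_data H" using eq_glue by (force simp: image_iff)
  qed
qed

lemma card_bridgeless_maps_on:
  assumes "finite H" "card H \<noteq> 1"
  shows "card (bridgeless_maps_on H) = (\<Sum>u\<in>H. \<Sum>A\<in>Pow (H - {u}).
    card (bridgeless_maps_on A) * (card A * card (bridgeless_maps_on (H - {u} - A))))"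
proof -
  let ?F = "\<lambda>u A. bridgeless_maps_on A \<times> A \<times> bridgeless_maps_on (H - {u} - A)"
  have finite_F: "finite (?F u A)" if "A \<in> Pow (H - {u})" for u A
  proof -
    have "finite A" using that assms(1) by (auto intro: finite_subset)
    then show ?thesis using assms(1) by (simp add: finite_bridgeless_maps_on)
  qed
  have "card (bridgeless_maps_on H) = card (glue_data H)"
    using bij_betw_glue[OF assms(2)] by (rule bij_betw_same_card[symmetric])
  also have "\<dots> = (\<Sum>u\<in>H. card (SIGMA A:Pow (H - {u}). ?F u A))"
    unfolding glue_data_def
    using assms(1) by (intro card_SigmaI ballI finite_SigmaI finite_F) simp_all
  also have "\<dots> = (\<Sum>u\<in>H. \<Sum>A\<in>Pow (H - {u}). card (?F u A))"
    using assms(1) by (intro sum.cong refl card_SigmaI ballI finite_F) simp_all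
  finally show ?thesis by (simp add: card_cartesian_product)
qed

lemma sum_Pow_card:
  fixes f :: "nat \<Rightarrow> 'a :: semiring_1"
  assumes "finite B"
  shows "(\<Sum>A\<in>Pow B. f (card A)) = (\<Sum>k\<le>card B. of_nat (card B choose k) * f k)"
proof -
  have "(\<Sum>A\<in>Pow B. f (card A)) = (\<Sum>k\<le>card B. \<Sum>A | A \<in> Pow B \<and> card A = k. f (card A))"
    using assms by (intro sum.group[symmetric]) (auto intro: card_mono)
  also have "\<dots> = (\<Sum>k\<le>card B. of_nat (card B choose k) * f k)"
    using n_subsets[OF assms] by (simp add: Pow_def)
  finally show ?thesis .
qed

lemma card_bridgeless_maps_on_binomial:
  assumes "m \<noteq> 1"
  defines "l \<equiv> \<lambda>m. card (bridgeless_maps_on {0..<m})"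
  shows "l m = m * (\<Sum>k\<le>m - 1. (m - 1 choose k) * (l k * (k * l (m - 1 - k))))"
proof -
  let ?H = "{0..<m}"
  have l: "card (bridgeless_maps_on A) = l (card A)" if "finite A" for A :: "nat set"
    unfolding l_def using that by (intro card_bridgeless_maps_on_cong) simp_all
  let ?F = "\<lambda>u A. card (bridgeless_maps_on A) * (card A * card (bridgeless_maps_on (?H - {u} - A)))"
  have "(\<Sum>A\<in>Pow (?H - {u}). ?F u A) = (\<Sum>k\<le>m - 1. (m - 1 choose k) * (l k * (k * l (m - 1 - k))))"
    if "u \<in> ?H" for u
  proof -
    have card: "card (?H - {u}) = m - 1" using that by simp
    have "card (?H - {u} - A) = m - 1 - card A" if "A \<in> Pow (?H - {u})" for A
      using that card finite_subset[of A "?H - {u}"] by (simp add: card_Diff_subset)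
    then have "(\<Sum>A\<in>Pow (?H - {u}). ?F u A) =
        (\<Sum>A\<in>Pow (?H - {u}). l (card A) * (card A * l (m - 1 - card A)))"
      by (intro sum.cong refl) (use finite_subset[of _ "?H - {u}"] in \<open>simp add: l\<close>)
    then show ?thesis
      using sum_Pow_card[of "?H - {u}" "\<lambda>k. l k * (k * l (m - 1 - k))"] card by simp
  qed
  then show ?thesis
    using card_bridgeless_maps_on[of ?H] assms(1) by (simp add: l_def)
qed

lemma sum_odd_indices:
  fixes f :: "nat \<Rightarrow> 'a :: comm_monoid_add"
  assumes "\<And>k. even k \<Longrightarrow> f k = 0"
  shows "(\<Sum>k\<le>2 * m. f k) = (\<Sum>k\<in>{1..<Suc m}. f (2 * k - 1))"
  by (induction m) (simp_all add: assms)

lemma num_bridgeless_maps_rec: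
  assumes n: "n \<ge> 2"
  shows "num_bridgeless_maps n =
    (\<Sum>k\<in>{1..<n}. (2 * k - 1) * num_bridgeless_maps k * num_bridgeless_maps (n - k))"
proof -
  let ?c = num_bridgeless_maps
  define l where "l m = card (bridgeless_maps_on {0..<m})" for m :: nat
  define t where "t k = (2 * n - 2 choose k) * (l k * (k * l (2 * n - 2 - k)))" for k
  have t_odd: "t (2 * k - 1) = fact (2 * n - 2) * ((2 * k - 1) * ?c k * ?c (n - k))"
    if "k \<in> {1..<n}" for k
  proof -
    have k: "k \<ge> 1" "n - k \<ge> 1" "2 * k - 1 \<le> 2 * n - 2" "2 * n - 2 - (2 * k - 1) = 2 * (n - k) - 1"
      using that by auto
    have "t (2 * k - 1) = (2 * n - 2 choose (2 * k - 1)) *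
        (fact (2 * k - 1) * ?c k * ((2 * k - 1) * (fact (2 * (n - k) - 1) * ?c (n - k))))"
      using num_bridgeless_maps_fact[OF k(1)] num_bridgeless_maps_fact[OF k(2)] k(4)
      by (simp add: t_def l_def)
    also have "\<dots> = (fact (2 * k - 1) * fact (2 * (n - k) - 1) * (2 * n - 2 choose (2 * k - 1))) *
        ((2 * k - 1) * ?c k * ?c (n - k))" by (simp only: mult_ac)
    finally show ?thesis using binomial_fact_lemma[OF k(3)] k(4) by simp
  qed
  have "fact (2 * n - 1) * ?c n = l (2 * n - 1)"
    using n num_bridgeless_maps_fact[of n] by (simp add: l_def)
  also have "\<dots> = (2 * n - 1) * (\<Sum>k\<le>2 * n - 2. t k)"
    using card_bridgeless_maps_on_binomial[of "2 * n - 1"] n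
    by (simp add: l_def t_def numeral_2_eq_2)
  also have "(\<Sum>k\<le>2 * n - 2. t k) = (\<Sum>k\<in>{1..<n}. t (2 * k - 1))"
  proof -
    have "t k = 0" if "even k" for k
      using that by (simp add: t_def l_def bridgeless_maps_on_even)
    moreover have "2 * n - 2 = 2 * (n - 1)" "Suc (n - 1) = n" using n by simp_all
    ultimately show ?thesis using sum_odd_indices[of t "n - 1"] by metis
  qed
  also have "\<dots> = fact (2 * n - 2) * (\<Sum>k\<in>{1..<n}. (2 * k - 1) * ?c k * ?c (n - k))"
    using t_odd by (simp add: sum_distrib_left)
  also have "(2 * n - 1) * \<dots> = fact (2 * n - 1) * (\<Sum>k\<in>{1..<n}. (2 * k - 1) * ?c k * ?c (n - k))"
    using n fact_reduce[of "2 * n - 1", where 'a = nat] by (simp add: numeral_2_eq_2)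
  finally show ?thesis by simp
qed

section \<open>Crossing-connected sets of chords\<close>

definition crossing_connected :: "(nat \<times> nat) set \<Rightarrow> bool" where
  "crossing_connected C \<longleftrightarrow> (\<forall>D\<subseteq>C. D \<noteq> {} \<longrightarrow> D \<noteq> C \<longrightarrow> (\<exists>p\<in>D. \<exists>q\<in>C - D. crosses p q))"

lemma crosses_commute: "crosses p q \<longleftrightarrow> crosses q p"
  by (auto simp: crosses_def)

lemma crossing_connectedE:
  assumes "crossing_connected C" "D \<subseteq> C" "D \<noteq> {}" "D \<noteq> C"
  obtains p q where "p \<in> D" "q \<in> C" "q \<notin> D" "crosses p q"
  using assms unfolding crossing_connected_def by blast

lemma crossing_connectedI:
  assumes "r \<in> C"
    and exit: "\<And>D. D \<subseteq> C \<Longrightarrow> D \<noteq> {} \<Longrightarrow> r \<notin> D \<Longrightarrow> \<exists>p\<in>D. \<exists>q\<in>C - D. crosses p q"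
  shows "crossing_connected C"
  unfolding crossing_connected_def
proof (intro allI impI)
  fix D assume D: "D \<subseteq> C" "D \<noteq> {}" "D \<noteq> C"
  show "\<exists>p\<in>D. \<exists>q\<in>C - D. crosses p q"
  proof (cases "r \<in> D")
    case True
    then obtain p q where "p \<in> C - D" "q \<in> C - (C - D)" "crosses p q"
      using exit[of "C - D"] D by auto
    then show ?thesis using crosses_commute by blast
  qed (use D exit in blast)
qed

lemma connected_diagram_iff: "connected_diagram C \<longleftrightarrow> crossing_connected C"
proof
  let ?R = "{(p, q). p \<in> C \<and> q \<in> C \<and> crosses p q}"
  assume connected: "connected_diagram C"
  show "crossing_connected C" unfolding crossing_connected_def
  proof (intro allI impI)
    fix D assume D: "D \<subseteq> C" "D \<noteq> {}" "D \<noteq> C"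
    then obtain c d where "c \<in> D" "d \<in> C" "d \<notin> D" by blast
    then have "(c, d) \<in> ?R\<^sup>*" using connected D by (auto simp: connected_diagram_def)
    then show "\<exists>p\<in>D. \<exists>q\<in>C - D. crosses p q"
      using \<open>c \<in> D\<close> \<open>d \<notin> D\<close> by (induction rule: rtrancl_induct) auto
  qed
next
  let ?R = "{(p, q). p \<in> C \<and> q \<in> C \<and> crosses p q}"
  assume connected: "crossing_connected C"
  show "connected_diagram C" unfolding connected_diagram_def
  proof (intro ballI)
    fix c d assume "c \<in> C" "d \<in> C"
    let ?D = "{d \<in> C. (c, d) \<in> ?R\<^sup>*}"
    have "?D = C"
    proof (rule ccontr)
      assume "?D \<noteq> C"
      have "?D \<subseteq> C" "?D \<noteq> {}" using \<open>c \<in> C\<close> by blast+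
      then obtain p q where "p \<in> ?D" "q \<in> C" "q \<notin> ?D" "crosses p q"
        using \<open>?D \<noteq> C\<close> by (rule crossing_connectedE[OF connected])
      moreover from this have "(c, p) \<in> ?R\<^sup>*" "(p, q) \<in> ?R" by auto
      then have "(c, q) \<in> ?R\<^sup>*" by (rule rtrancl_into_rtrancl)
      ultimately show False by blast
    qed
    then show "(c, d) \<in> ?R\<^sup>*" using \<open>d \<in> C\<close> by blast
  qed
qed

lemma crossing_connected_image:
  assumes "crossing_connected C"
    and "\<And>p q. p \<in> C \<Longrightarrow> q \<in> C \<Longrightarrow> crosses p q \<Longrightarrow> crosses (f p) (f q)"
  shows "crossing_connected (f ` C)"
  unfolding crossing_connected_def
proof (intro allI impI)
  fix D assume D: "D \<subseteq> f ` C" "D \<noteq> {}" "D \<noteq> f ` C"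
  let ?D = "{p \<in> C. f p \<in> D}"
  have "?D \<subseteq> C" "?D \<noteq> {}" "?D \<noteq> C" using D by auto
  with assms(1) obtain p q where "p \<in> ?D" "q \<in> C" "q \<notin> ?D" "crosses p q"
    by (rule crossing_connectedE)
  then show "\<exists>p\<in>D. \<exists>q\<in>f ` C - D. crosses p q" using assms(2) by blast
qed

lemma crossing_connected_Un:
  assumes X: "crossing_connected X" and Y: "crossing_connected Y"
    and cross: "p \<in> X" "q \<in> Y" "crosses p q"
  shows "crossing_connected (X \<union> Y)"
proof (rule crossing_connectedI)
  show "q \<in> X \<union> Y" using cross(2) by blast
  fix D assume D: "D \<subseteq> X \<union> Y" "D \<noteq> {}" "q \<notin> D"
  consider "D \<inter> Y \<noteq> {}" | "D \<subseteq> X" "D \<noteq> X" | "D = X" using D(1) by blast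
  then show "\<exists>p\<in>D. \<exists>q\<in>X \<union> Y - D. crosses p q"
  proof cases
    case 1
    have "D \<inter> Y \<noteq> Y" using cross(2) D(3) by auto
    then obtain p' q' where "p' \<in> D \<inter> Y" "q' \<in> Y" "q' \<notin> D \<inter> Y" "crosses p' q'"
      by (rule crossing_connectedE[OF Y Int_lower2 1])
    then show ?thesis by blast
  next
    case 2
    then obtain p' q' where "p' \<in> D" "q' \<in> X" "q' \<notin> D" "crosses p' q'"
      by (rule crossing_connectedE[OF X _ D(2)])
    then show ?thesis by blast
  next
    case 3
    then show ?thesis using cross D(3) by blast
  qed
qed

lemma crossing_component:
  assumes "c \<in> C"
  obtains X where "c \<in> X" "X \<subseteq> C" "crossing_connected X"
    "\<And>p q. p \<in> X \<Longrightarrow> q \<in> C - X \<Longrightarrow> \<not> crosses p q"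
proof -
  let ?R = "{(p, q). p \<in> C \<and> q \<in> C \<and> crosses p q}"
  let ?X = "{q. (c, q) \<in> ?R\<^sup>*}"
  have sub: "?X \<subseteq> C"
  proof
    fix q assume "q \<in> ?X"
    then have "(c, q) \<in> ?R\<^sup>*" by simp
    then show "q \<in> C" using assms by (induction rule: rtrancl_induct) auto
  qed
  moreover have "crossing_connected ?X"
  proof (rule crossing_connectedI)
    fix D assume D: "D \<subseteq> ?X" "D \<noteq> {}" "c \<notin> D"
    show "\<exists>p\<in>D. \<exists>q\<in>?X - D. crosses p q"
    proof (rule ccontr)
      assume none: "\<not> ?thesis"
      have "q \<notin> D" if "(c, q) \<in> ?R\<^sup>*" for q
        using that
      proof (induction rule: rtrancl_induct)
        case base
        show ?case by (rule D(3))
      next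
        case (step p q)
        then show ?case using none crosses_commute by blast
      qed
      then show False using D(1,2) by blast
    qed
  qed simp
  moreover have "\<not> crosses p q" if "p \<in> ?X" "q \<in> C - ?X" for p q
    using that sub by (auto dest: rtrancl_into_rtrancl)
  ultimately show thesis using that[of ?X] by blast
qed

lemma crossing_connected_Diff:
  assumes C: "crossing_connected C" and r: "r \<in> C - X"
    and component: "\<And>p q. p \<in> X \<Longrightarrow> q \<in> C - X \<Longrightarrow> q \<noteq> r \<Longrightarrow> \<not> crosses p q"
  shows "crossing_connected (C - X)"
proof (rule crossing_connectedI[OF r])
  fix D assume D: "D \<subseteq> C - X" "D \<noteq> {}" "r \<notin> D"
  then have "D \<subseteq> C" "D \<noteq> C" using r by auto
  then obtain p q where "p \<in> D" "q \<in> C" "q \<notin> D" "crosses p q"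
    by (rule crossing_connectedE[OF C _ D(2)])
  then show "\<exists>p\<in>D. \<exists>q\<in>C - X - D. crosses p q"
    using component[of q p] crosses_commute D by blast
qed

lemma crossing_connected_same_side:
  assumes "crossing_connected C" and sides: "\<And>p. p \<in> C \<Longrightarrow> snd p < z \<or> z < fst p"
  shows "(\<forall>p\<in>C. snd p < z) \<or> (\<forall>p\<in>C. z < fst p)"
proof (rule ccontr)
  assume not_same: "\<not> ?thesis"
  let ?D = "{p \<in> C. snd p < z}"
  have "?D \<subseteq> C" "?D \<noteq> {}" "?D \<noteq> C" using not_same sides by blast+
  with assms(1) obtain p q where "p \<in> ?D" "q \<in> C" "q \<notin> ?D" "crosses p q"
    by (rule crossing_connectedE)
  then show False using sides[of q] by (auto simp: crosses_def)
qed

section \<open>Matchings\<close>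

definition ends :: "(nat \<times> nat) set \<Rightarrow> nat set" where
  "ends C = (\<Union>p\<in>C. {fst p, snd p})"

definition matching :: "nat set \<Rightarrow> (nat \<times> nat) set \<Rightarrow> bool" where
  "matching A C \<longleftrightarrow> (\<forall>p\<in>C. fst p < snd p) \<and> ends C = A \<and>
     (\<forall>p\<in>C. \<forall>q\<in>C. p \<noteq> q \<longrightarrow> {fst p, snd p} \<inter> {fst q, snd q} = {})"

definition connected_matchings :: "nat set \<Rightarrow> (nat \<times> nat) set set" where
  "connected_matchings A = {C. matching A C \<and> crossing_connected C}"

lemma in_endsI: "p \<in> C \<Longrightarrow> fst p \<in> ends C" "p \<in> C \<Longrightarrow> snd p \<in> ends C"
  by (auto simp: ends_def)

lemma in_endsE:
  assumes "z \<in> ends C"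
  obtains p where "p \<in> C" "z = fst p \<or> z = snd p"
  using assms by (auto simp: ends_def)

lemma ends_Un: "ends (C \<union> D) = ends C \<union> ends D"
  by (auto simp: ends_def)

lemma
  assumes "matching A C"
  shows matching_ends: "ends C = A"
    and matching_less: "p \<in> C \<Longrightarrow> fst p < snd p"
    and matching_fst_in: "p \<in> C \<Longrightarrow> fst p \<in> A"
    and matching_snd_in: "p \<in> C \<Longrightarrow> snd p \<in> A"
    and matching_disjoint: "p \<in> C \<Longrightarrow> q \<in> C \<Longrightarrow> p \<noteq> q \<Longrightarrow> {fst p, snd p} \<inter> {fst q, snd q} = {}"
  using assms by (auto simp: matching_def ends_def)

lemma matching_subset_Times: "matching A C \<Longrightarrow> C \<subseteq> A \<times> A"
  using matching_fst_in matching_snd_in by (auto simp: mem_Times_iff)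

lemma matching_subset: "matching A C \<Longrightarrow> D \<subseteq> C \<Longrightarrow> matching (ends D) D"
  unfolding matching_def by blast

lemma ends_Diff:
  assumes "matching A C" "D \<subseteq> C"
  shows "ends (C - D) = A - ends D"
proof -
  have "ends (C - D) \<inter> ends D = {}"
    using matching_disjoint[OF assms(1)] assms(2) unfolding ends_def by blast
  moreover have "ends (C - D) \<union> ends D = A"
    using assms by (simp add: ends_Un[symmetric] Un_absorb2 matching_ends)
  ultimately show ?thesis by blast
qed

lemma matching_Un:
  assumes C: "matching A C" and D: "matching B D" and "A \<inter> B = {}"
  shows "matching (A \<union> B) (C \<union> D)"
proof -
  have cross: "{fst p, snd p} \<inter> {fst q, snd q} = {}" if "p \<in> C" "q \<in> D" for p q
    using matching_fst_in[OF C that(1)] matching_snd_in[OF C that(1)]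
      matching_fst_in[OF D that(2)] matching_snd_in[OF D that(2)] assms(3) by auto
  have "{fst p, snd p} \<inter> {fst q, snd q} = {}" if pq: "p \<in> C \<union> D" "q \<in> C \<union> D" "p \<noteq> q" for p q
  proof -
    consider "p \<in> C" "q \<in> C" | "p \<in> C" "q \<in> D" | "q \<in> C" "p \<in> D" | "p \<in> D" "q \<in> D" using pq by blast
    then show ?thesis
      by cases (use pq(3) cross matching_disjoint[OF C] matching_disjoint[OF D] in blast)+
  qed
  then show ?thesis
    using matching_less[OF C] matching_less[OF D] matching_ends[OF C] matching_ends[OF D]
    by (auto simp: matching_def ends_Un)
qed

lemma finite_matching: "matching A C \<Longrightarrow> finite A \<Longrightarrow> finite C"
  by (rule finite_subset[OF matching_subset_Times]) auto

lemma card_matching: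
  assumes "matching A C" "finite A"
  shows "card A = 2 * card C"
proof -
  have "card (ends C) = (\<Sum>p\<in>C. card {fst p, snd p})" unfolding ends_def
    using finite_matching[OF assms] matching_disjoint[OF assms(1)] by (intro card_UN_disjoint) auto
  also have "\<dots> = (\<Sum>p\<in>C. 2)"
  proof (rule sum.cong)
    show "card {fst p, snd p} = 2" if "p \<in> C" for p using matching_less[OF assms(1) that] by auto
  qed simp
  finally show ?thesis using matching_ends[OF assms(1)] by simp
qed

lemma chord_diagram_iff_matching: "chord_diagram n C \<longleftrightarrow> matching {0..<2 * n} C"
proof
  assume diagram: "chord_diagram n C"
  have chord: "fst p < snd p \<and> snd p < 2 * n" if "p \<in> C" for p
    using diagram that by (auto simp: chord_diagram_def)
  have ex1: "\<exists>!p. p \<in> C \<and> (z = fst p \<or> z = snd p)" if "z < 2 * n" for z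
    using diagram that by (auto simp: chord_diagram_def)
  have "p = q" if "p \<in> C" "q \<in> C" "z \<in> {fst p, snd p}" "z \<in> {fst q, snd q}" for p q z
  proof -
    have "z < 2 * n" using chord[OF that(1)] that(3) by auto
    then show ?thesis using ex1[of z] that by blast
  qed
  then have "{fst p, snd p} \<inter> {fst q, snd q} = {}" if "p \<in> C" "q \<in> C" "p \<noteq> q" for p q
    using that by blast
  moreover have "ends C = {0..<2 * n}"
  proof (intro equalityI subsetI)
    fix z assume "z \<in> ends C"
    then show "z \<in> {0..<2 * n}" using chord by (fastforce elim: in_endsE)
  next
    fix z assume "z \<in> {0..<2 * n}"
    then obtain p where "p \<in> C" "z = fst p \<or> z = snd p" using ex1[of z] by auto
    then show "z \<in> ends C" using in_endsI by blast
  qed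
  ultimately show "matching {0..<2 * n} C" using chord by (simp add: matching_def)
next
  assume matching: "matching {0..<2 * n} C"
  have "\<exists>!p. p \<in> C \<and> (z = fst p \<or> z = snd p)" if "z < 2 * n" for z
  proof -
    have "z \<in> ends C" using that by (simp add: matching_ends[OF matching])
    then obtain p where "p \<in> C" "z = fst p \<or> z = snd p" by (rule in_endsE)
    then show ?thesis using matching_disjoint[OF matching, of p] by blast
  qed
  moreover have "C \<subseteq> {(a, b). a < b \<and> b < 2 * n}"
    using matching_less[OF matching] matching_snd_in[OF matching] by fastforce
  ultimately show "chord_diagram n C" unfolding chord_diagram_def by blast
qed

lemma connected_chord_diagrams_eq: "connected_chord_diagrams n = connected_matchings {0..<2 * n}"
  by (simp add: connected_chord_diagrams_def connected_matchings_def connected_diagram_iff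
      chord_diagram_iff_matching)

lemma connected_matchings_subset: "connected_matchings A \<subseteq> Pow (A \<times> A)"
  using matching_subset_Times by (auto simp: connected_matchings_def)

lemma finite_connected_matchings: "finite A \<Longrightarrow> finite (connected_matchings A)"
  by (rule finite_subset[OF connected_matchings_subset]) simp

lemma matching_image:
  assumes C: "matching A C" and f: "strict_mono_on A f"
  shows "matching (f ` A) (map_prod f f ` C)"
proof -
  have inj: "inj_on f A" using f by (rule strict_mono_on_imp_inj_on)
  have in_A: "{fst p, snd p} \<subseteq> A" if "p \<in> C" for p
    using matching_fst_in[OF C that] matching_snd_in[OF C that] by simp
  have "f (fst p) < f (snd p)" if "p \<in> C" for p
    using strict_mono_onD[OF f] in_A[OF that] matching_less[OF C that] by simp
  moreover have "{fst p', snd p'} \<inter> {fst q', snd q'} = {}"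
    if p': "p' \<in> map_prod f f ` C" and q': "q' \<in> map_prod f f ` C" and "p' \<noteq> q'" for p' q'
  proof -
    obtain p where p: "p' = map_prod f f p" "p \<in> C" using p' by (rule imageE)
    obtain q where q: "q' = map_prod f f q" "q \<in> C" using q' by (rule imageE)
    have "{fst p, snd p} \<inter> {fst q, snd q} = {}"
      using matching_disjoint[OF C p(2) q(2)] \<open>p' \<noteq> q'\<close> p(1) q(1) by blast
    then have "f ` {fst p, snd p} \<inter> f ` {fst q, snd q} = {}"
      using inj_on_image_Int[OF inj in_A[OF p(2)] in_A[OF q(2)]] by simp
    then show ?thesis by (simp add: p(1) q(1))
  qed
  moreover have "ends (map_prod f f ` C) = f ` ends C" by (auto simp: ends_def)
  ultimately show ?thesis
    using matching_ends[OF C] by (simp add: matching_def)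
qed

lemma connected_matchings_image:
  assumes "C \<in> connected_matchings A" and f: "strict_mono_on A f"
  shows "map_prod f f ` C \<in> connected_matchings (f ` A)"
proof -
  have C: "matching A C" "crossing_connected C"
    using assms(1) by (auto simp: connected_matchings_def)
  have "crosses (map_prod f f p) (map_prod f f q)" if "p \<in> C" "q \<in> C" "crosses p q" for p q
    using that matching_fst_in[OF C(1)] matching_snd_in[OF C(1)] strict_mono_on_less[OF f]
    by (simp add: crosses_def)
  with C(2) have "crossing_connected (map_prod f f ` C)" by (rule crossing_connected_image)
  then show ?thesis using matching_image[OF C(1) f] by (simp add: connected_matchings_def)
qed

lemma card_connected_matchings_image_le:
  assumes "finite A" and f: "strict_mono_on A f"
  shows "card (connected_matchings A) \<le> card (connected_matchings (f ` A))"
proof (rule card_inj_on_le)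
  have "inj_on (map_prod f f) (A \<times> A)"
    using strict_mono_on_imp_inj_on[OF f] by (intro map_prod_inj_on)
  then show "inj_on ((`) (map_prod f f)) (connected_matchings A)"
    using connected_matchings_subset by (rule inj_on_subset[OF inj_on_image_Pow])
  show "(`) (map_prod f f) ` connected_matchings A \<subseteq> connected_matchings (f ` A)"
    using connected_matchings_image[OF _ f] by blast
  show "finite (connected_matchings (f ` A))"
    using assms(1) by (simp add: finite_connected_matchings)
qed

lemma card_connected_matchings:
  assumes "finite A" "card A = 2 * k"
  shows "card (connected_matchings A) = card (connected_chord_diagrams k)"
proof -
  obtain h where h: "bij_betw h {0..<2 * k} A" "strict_mono_on {0..<2 * k} h"
    using ex_bij_betw_strict_mono_card[OF assms(1)] assms(2) unfolding atLeast0LessThan by metis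
  let ?g = "inv_into {0..<2 * k} h"
  have g: "bij_betw ?g A {0..<2 * k}" using h(1) by (rule bij_betw_inv_into)
  have "strict_mono_on A ?g"
  proof (rule strict_mono_onI)
    fix a b assume "a \<in> A" "b \<in> A" "a < b"
    moreover from this have "h (?g a) = a" "h (?g b) = b" "?g a \<in> {0..<2 * k}" "?g b \<in> {0..<2 * k}"
      using bij_betw_inv_into_right[OF h(1)] bij_betw_apply[OF g] by blast+
    ultimately show "?g a < ?g b" using strict_mono_on_less[OF h(2)] by metis
  qed
  then have "card (connected_matchings A) \<le> card (connected_matchings {0..<2 * k})"
    using card_connected_matchings_image_le[OF assms(1)] bij_betw_imp_surj_on[OF g] by metis
  moreover have "card (connected_matchings {0..<2 * k}) \<le> card (connected_matchings A)"
    using card_connected_matchings_image_le[OF _ h(2)] bij_betw_imp_surj_on[OF h(1)] by simp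
  ultimately show ?thesis by (simp add: connected_chord_diagrams_eq)
qed

lemma card_connected_chord_diagrams_1: "card (connected_chord_diagrams 1) = 1"
proof -
  have "connected_matchings {0..<2} = {{(0, 1)}}"
  proof (intro equalityI subsetI)
    fix C assume "C \<in> connected_matchings {0..<2}"
    then have C: "matching {0..<2} C" by (simp add: connected_matchings_def)
    have "p = (0, 1)" if "p \<in> C" for p
      using matching_less[OF C that] matching_snd_in[OF C that] by (cases p) auto
    moreover have "C \<noteq> {}" using matching_ends[OF C] by (auto simp: ends_def)
    ultimately show "C \<in> {{(0, 1)}}" by auto
  next
    fix C :: "(nat \<times> nat) set" assume "C \<in> {{(0, 1)}}"
    then show "C \<in> connected_matchings {0..<2}"
      by (auto simp: connected_matchings_def matching_def crossing_connected_def ends_def)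
  qed
  then show ?thesis by (simp add: connected_chord_diagrams_eq)
qed

section \<open>Nested diagrams\<close>

text \<open>A diagram with \<open>n - k\<close> chords, except for its first point 0, sits in the gap after the
  \<open>i\<close>-th point of a diagram with \<open>k\<close> chords.\<close>

definition outer_points :: "nat \<Rightarrow> nat \<Rightarrow> nat \<Rightarrow> nat set" where
  "outer_points n k i = {1..i} \<union> {i + 2 * (n - k)..<2 * n}"

definition inner_points :: "nat \<Rightarrow> nat \<Rightarrow> nat \<Rightarrow> nat set" where
  "inner_points n k i = insert 0 {i + 1..<i + 2 * (n - k)}"

lemma finite_points [simp]: "finite (outer_points n k i)" "finite (inner_points n k i)"
  by (simp_all add: outer_points_def inner_points_def)

lemma
  assumes "k \<in> {1..<n}" "i \<in> {1..2 * k - 1}"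
  shows outer_inner_disjoint: "outer_points n k i \<inter> inner_points n k i = {}"
    and outer_inner_Un: "outer_points n k i \<union> inner_points n k i = {0..<2 * n}"
    and card_outer_points: "card (outer_points n k i) = 2 * k"
    and card_inner_points: "card (inner_points n k i) = 2 * (n - k)"
proof -
  show "outer_points n k i \<inter> inner_points n k i = {}"
    "outer_points n k i \<union> inner_points n k i = {0..<2 * n}"
    using assms by (auto simp: outer_points_def inner_points_def)
  have "card (outer_points n k i) = card {1..i} + card {i + 2 * (n - k)..<2 * n}"
    unfolding outer_points_def by (rule card_Un_disjoint) (use assms in auto)
  then show "card (outer_points n k i) = 2 * k" using assms by auto
  show "card (inner_points n k i) = 2 * (n - k)" using assms by (auto simp: inner_points_def)
qed

locale nesting =
  fixes n k i :: nat and X Y :: "(nat \<times> nat) set"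
  assumes k: "k \<in> {1..<n}" and i: "i \<in> {1..2 * k - 1}"
    and X: "X \<in> connected_matchings (outer_points n k i)"
    and Y: "Y \<in> connected_matchings (inner_points n k i)"
begin

lemma matching_X: "matching (outer_points n k i) X" and connected_X: "crossing_connected X"
  using X by (simp_all add: connected_matchings_def)

lemma matching_Y: "matching (inner_points n k i) Y" and connected_Y: "crossing_connected Y"
  using Y by (simp_all add: connected_matchings_def)

lemma not_crosses:
  assumes "p \<in> X" "q \<in> Y" "fst q \<noteq> 0"
  shows "\<not> crosses p q"
  using matching_less[OF matching_X assms(1)] matching_less[OF matching_Y assms(2)]
    matching_fst_in[OF matching_X assms(1)] matching_snd_in[OF matching_X assms(1)]
    matching_fst_in[OF matching_Y assms(2)] matching_snd_in[OF matching_Y assms(2)] assms(3)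
  by (auto simp: crosses_def outer_points_def inner_points_def)

lemma chord_at_1: "\<exists>p\<in>X. fst p = 1"
proof -
  have "1 \<in> ends X" using matching_ends[OF matching_X] i by (auto simp: outer_points_def)
  then obtain p where p: "p \<in> X" "1 = fst p \<or> 1 = snd p" by (rule in_endsE)
  then have "fst p = 1"
    using matching_less[OF matching_X p(1)] matching_fst_in[OF matching_X p(1)] k i
    by (auto simp: outer_points_def)
  then show ?thesis using p(1) by blast
qed

lemma chord_at_0: "\<exists>q\<in>Y. fst q = 0 \<and> i < snd q \<and> snd q < i + 2 * (n - k)"
proof -
  have "0 \<in> ends Y" using matching_ends[OF matching_Y] by (auto simp: inner_points_def)
  then obtain q where q: "q \<in> Y" "0 = fst q \<or> 0 = snd q" by (rule in_endsE)
  then show ?thesis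
    using matching_less[OF matching_Y q(1)] matching_snd_in[OF matching_Y q(1)]
    by (intro bexI[OF _ q(1)]) (auto simp: inner_points_def)
qed

lemma chord_around_gap: "\<exists>p\<in>X. fst p \<le> i \<and> i + 2 * (n - k) \<le> snd p"
proof (rule ccontr)
  assume none: "\<not> ?thesis"
  have "snd p < i + 1 \<or> i + 1 < fst p" if "p \<in> X" for p
    using none that k matching_fst_in[OF matching_X that] matching_snd_in[OF matching_X that]
    by (auto simp: outer_points_def)
  then have "(\<forall>p\<in>X. snd p < i + 1) \<or> (\<forall>p\<in>X. i + 1 < fst p)"
    using connected_X by (intro crossing_connected_same_side)
  moreover obtain p where "p \<in> X" "fst p = 1" using chord_at_1 by blast
  moreover have "i + 2 * (n - k) \<in> ends X"
    using matching_ends[OF matching_X] i k by (auto simp: outer_points_def)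
  then obtain q where "q \<in> X" "i + 2 * (n - k) \<le> snd q"
    using matching_less[OF matching_X] by (fastforce elim: in_endsE)
  ultimately show False using k i by fastforce
qed

lemma crosses_exists: "\<exists>p\<in>X. \<exists>q\<in>Y. crosses p q"
proof -
  obtain p where p: "p \<in> X" "fst p \<le> i" "i + 2 * (n - k) \<le> snd p" using chord_around_gap by blast
  obtain q where q: "q \<in> Y" "fst q = 0" "i < snd q" "snd q < i + 2 * (n - k)"
    using chord_at_0 by blast
  have "fst p > 0" using matching_fst_in[OF matching_X p(1)] k i by (auto simp: outer_points_def)
  then have "crosses p q" using p q by (auto simp: crosses_def)
  then show ?thesis using p(1) q(1) by blast
qed

lemma Un_in_connected_matchings: "X \<union> Y \<in> connected_matchings {0..<2 * n}"
proof -
  have "matching {0..<2 * n} (X \<union> Y)"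
    using matching_Un[OF matching_X matching_Y] outer_inner_disjoint[OF k i] outer_inner_Un[OF k i]
    by simp
  moreover have "crossing_connected (X \<union> Y)"
    using crosses_exists crossing_connected_Un[OF connected_X connected_Y] by blast
  ultimately show ?thesis by (simp add: connected_matchings_def)
qed

lemma disjoint: "X \<inter> Y = {}"
  using matching_fst_in[OF matching_X] matching_fst_in[OF matching_Y] outer_inner_disjoint[OF k i]
  by blast

lemma card_X: "card X = k"
  using card_matching[OF matching_X] card_outer_points[OF k i] by simp

end

lemma nesting_subset:
  assumes "nesting n k i X Y" "nesting n k' i' X' Y'" "X \<union> Y = X' \<union> Y'"
  shows "X \<subseteq> X'"
proof (rule ccontr)
  assume not_subset: "\<not> X \<subseteq> X'"
  interpret A: nesting n k i X Y by fact
  interpret B: nesting n k' i' X' Y' by fact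
  have matching: "matching {0..<2 * n} (X \<union> Y)"
    using A.Un_in_connected_matchings by (simp add: connected_matchings_def)
  obtain p where p: "p \<in> X" "fst p = 1" using A.chord_at_1 by blast
  obtain p' where p': "p' \<in> X'" "fst p' = 1" using B.chord_at_1 by blast
  have "p = p'" using matching_disjoint[OF matching, of p p'] p p' assms(3) by auto
  then have "X \<inter> X' \<noteq> {}" "X \<inter> X' \<noteq> X" using p p' not_subset by auto
  then obtain p q where pq: "p \<in> X \<inter> X'" "q \<in> X" "q \<notin> X \<inter> X'" "crosses p q"
    by (rule crossing_connectedE[OF A.connected_X Int_lower1])
  then have "q \<in> Y'" using assms(3) by blast
  then have "fst q = 0" using B.not_crosses[of p q] pq by blast
  then show False
    using matching_fst_in[OF A.matching_X pq(2)] A.k A.i by (auto simp: outer_points_def)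
qed

lemma nesting_unique:
  assumes "nesting n k i X Y" "nesting n k' i' X' Y'" "X \<union> Y = X' \<union> Y'"
  shows "k = k' \<and> i = i' \<and> X = X' \<and> Y = Y'"
proof -
  interpret A: nesting n k i X Y by fact
  interpret B: nesting n k' i' X' Y' by fact
  have X: "X = X'"
    using nesting_subset[OF assms] nesting_subset[OF assms(2,1) assms(3)[symmetric]] by blast
  have Y: "Y = Y'" using X A.disjoint B.disjoint assms(3) by blast
  have k: "k = k'" using A.card_X B.card_X X by simp
  have "inner_points n k i = inner_points n k i'"
    using matching_ends[OF A.matching_Y] matching_ends[OF B.matching_Y] Y k by simp
  moreover have "i + 1 \<in> inner_points n k i" "i' + 1 \<in> inner_points n k i'"
    using A.k by (auto simp: inner_points_def)
  ultimately have "i + 1 \<in> inner_points n k i'" "i' + 1 \<in> inner_points n k i" by auto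
  then have "i = i'" by (auto simp: inner_points_def)
  then show ?thesis using X Y k by blast
qed

section \<open>Removing the root chord\<close>

lemma convex_nat_set_eq_atLeastAtMost:
  fixes P :: "nat set"
  assumes "finite P" "P \<noteq> {}" and "\<And>a b z. a \<in> P \<Longrightarrow> b \<in> P \<Longrightarrow> a < z \<Longrightarrow> z < b \<Longrightarrow> z \<in> P"
  shows "P = {Min P..Max P}"
proof (intro equalityI subsetI)
  fix z assume "z \<in> {Min P..Max P}"
  then consider "z = Min P" | "z = Max P" | "Min P < z" "z < Max P" by fastforce
  then show "z \<in> P"
    by cases (use Min_in[OF assms(1,2)] Max_in[OF assms(1,2)] assms(3) in blast)+
qed (use assms(1) in auto)

locale root_component =
  fixes n :: nat and C X :: "(nat \<times> nat) set" and r c :: "nat \<times> nat"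
  assumes C: "C \<in> connected_matchings {0..<2 * n}"
    and r_in: "r \<in> C" and fst_r: "fst r = 0"
    and c_in: "c \<in> X" and fst_c: "fst c = 1"
    and X_subset: "X \<subseteq> C - {r}" and connected_X: "crossing_connected X"
    and component: "\<And>p q. p \<in> X \<Longrightarrow> q \<in> C - X \<Longrightarrow> q \<noteq> r \<Longrightarrow> \<not> crosses p q"
begin

definition "Y = C - X"

lemma matching_C: "matching {0..<2 * n} C" and connected_C: "crossing_connected C"
  using C by (simp_all add: connected_matchings_def)

lemma r_in_Y: "r \<in> Y"
  using r_in X_subset by (auto simp: Y_def)

lemma matching_X: "matching (ends X) X" and matching_Y: "matching (ends Y) Y"
  using matching_subset[OF matching_C] X_subset by (auto simp: Y_def)

lemma ends_Y: "ends Y = {0..<2 * n} - ends X"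
  using ends_Diff[OF matching_C] X_subset by (auto simp: Y_def)

lemma ends_X_subset: "ends X \<subseteq> {0..<2 * n}"
  using matching_ends[OF matching_C] X_subset unfolding ends_def by blast

lemma connected_Y: "crossing_connected Y"
  unfolding Y_def using connected_C r_in_Y component
  by (intro crossing_connected_Diff[of C r]) (auto simp: Y_def)

lemma not_end_of_both: "z \<in> ends X \<Longrightarrow> q \<in> Y \<Longrightarrow> z \<noteq> fst q \<and> z \<noteq> snd q"
  using ends_Y in_endsI[of q Y] by auto

lemma zero_in_ends_Y: "0 \<in> ends Y" and one_in_ends_X: "1 \<in> ends X"
  using in_endsI(1)[OF r_in_Y] in_endsI(1)[OF c_in] fst_r fst_c by simp_all

lemma fst_gt_1:
  assumes "q \<in> Y" "q \<noteq> r"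
  shows "1 < fst q"
proof -
  have "fst q \<noteq> 0" using matching_disjoint[OF matching_Y assms(1) r_in_Y assms(2)] fst_r by auto
  moreover have "fst q \<noteq> 1" using not_end_of_both[OF one_in_ends_X assms(1)] by simp
  ultimately show ?thesis by simp
qed

lemma ends_X_outside_chord:
  assumes z: "z \<in> ends X" and q: "q \<in> Y" "q \<noteq> r"
  shows "snd q < z \<or> z < fst q"
proof (rule ccontr)
  assume not_outside: "\<not> ?thesis"
  let ?inside = "\<lambda>p. fst q < fst p \<and> snd p < snd q"
  let ?D = "{p \<in> X. ?inside p}"
  have inside: "?inside p"
    if p: "p \<in> X" and w: "w = fst p \<or> w = snd p" "fst q < w" "w < snd q" for p w
  proof -
    have "\<not> crosses p q" using component[OF p] q by (simp add: Y_def)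
    then show ?thesis
      using w matching_less[OF matching_X p] not_end_of_both[OF in_endsI(1)[OF p] q(1)]
        not_end_of_both[OF in_endsI(2)[OF p] q(1)] by (auto simp: crosses_def)
  qed
  have "fst q < z" "z < snd q" using not_outside not_end_of_both[OF z q(1)] by auto
  then have "?D \<noteq> {}" using z inside by (blast elim: in_endsE)
  moreover have "c \<notin> ?D" using fst_gt_1[OF q] fst_c by simp
  then have "?D \<noteq> X" using c_in by blast
  ultimately obtain p p' where "p \<in> ?D" "p' \<in> X" "p' \<notin> ?D" "crosses p p'"
    by (rule crossing_connectedE[OF connected_X Collect_restrict])
  moreover from this have "?inside p'"
    using inside[of p' "fst p'"] inside[of p' "snd p'"] by (auto simp: crosses_def)
  ultimately show False by blast
qed

lemma ends_X_one_side:
  assumes z: "z \<in> ends X"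
  shows "(\<forall>a\<in>ends Y. a < z) \<or> (\<forall>a\<in>ends Y - {0}. z < a)"
proof -
  consider "snd r < z" | "z < snd r" using not_end_of_both[OF z r_in_Y] by linarith
  then show ?thesis
  proof cases
    case 1
    then have "snd q < z \<or> z < fst q" if "q \<in> Y" for q
      using ends_X_outside_chord[OF z that] by blast
    then have "(\<forall>q\<in>Y. snd q < z) \<or> (\<forall>q\<in>Y. z < fst q)"
      using connected_Y by (intro crossing_connected_same_side)
    then have "\<forall>q\<in>Y. snd q < z" using r_in_Y fst_r by fastforce
    then show ?thesis using matching_less[OF matching_Y] by (fastforce elim: in_endsE)
  next
    case 2
    let ?D = "{q \<in> Y. snd q < z}"
    have "?D = {}"
    proof (rule ccontr)
      assume "?D \<noteq> {}"
      moreover have "r \<notin> ?D" using 2 by simp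
      then have "?D \<noteq> Y" using r_in_Y by blast
      ultimately obtain p q where pq: "p \<in> ?D" "q \<in> Y" "q \<notin> ?D" "crosses p q"
        by (rule crossing_connectedE[OF connected_Y Collect_restrict])
      show False
      proof (cases "q = r")
        case True
        then show ?thesis
          using pq 2 fst_r matching_less[OF matching_Y, of p] by (auto simp: crosses_def)
      next
        case False
        then have "z < fst q" using pq ends_X_outside_chord[OF z] by blast
        then show ?thesis using pq by (auto simp: crosses_def)
      qed
    qed
    then have "z < fst q" if "q \<in> Y" "q \<noteq> r" for q using ends_X_outside_chord[OF z] that by blast
    then have "z < a" if "a \<in> ends Y" "a \<noteq> 0" for a
      using that 2 fst_r matching_less[OF matching_Y] by (fastforce elim!: in_endsE)
    then show ?thesis by blast
  qed
qed

lemma last_end_in_X: "\<exists>b\<in>ends X. \<forall>a\<in>ends Y. a < b"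
proof -
  have "X \<noteq> {}" "X \<noteq> C" "X \<subseteq> C" using c_in r_in X_subset by auto
  then obtain p q where pq: "p \<in> X" "q \<in> C" "q \<notin> X" "crosses p q"
    by (metis crossing_connectedE[OF connected_C])
  then have "q = r" using component by blast
  then have "snd r < snd p" using pq(4) fst_r by (auto simp: crosses_def)
  moreover have "snd r \<in> ends Y - {0}"
    using in_endsI(2)[OF r_in_Y] matching_less[OF matching_Y r_in_Y] by simp
  moreover have p: "snd p \<in> ends X" using pq(1) by (rule in_endsI)
  ultimately have "\<forall>a\<in>ends Y. a < snd p" using ends_X_one_side[OF p] less_asym by blast
  then show ?thesis using p by blast
qed

lemma ends_Y_interval:
  obtains l h where "ends Y = insert 0 {l..h}" "2 \<le> l" "l \<le> h"
proof -
  let ?P = "ends Y - {0}"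
  have "finite ?P" using ends_Y by simp
  moreover have "snd r \<in> ?P"
    using in_endsI(2)[OF r_in_Y] matching_less[OF matching_Y r_in_Y] by simp
  then have "?P \<noteq> {}" by blast
  moreover have "z \<in> ?P" if "a \<in> ?P" "b \<in> ?P" "a < z" "z < b" for a b z
  proof -
    have "z \<notin> ends X"
    proof
      assume "z \<in> ends X"
      then have "b < z \<or> z < a" using ends_X_one_side that(1,2) by blast
      then show False using that(3,4) by linarith
    qed
    then show ?thesis using that ends_Y by auto
  qed
  ultimately have P: "?P = {Min ?P..Max ?P}" by (rule convex_nat_set_eq_atLeastAtMost)
  have Min_P: "Min ?P \<in> ?P" using \<open>finite ?P\<close> \<open>?P \<noteq> {}\<close> by (rule Min_in)
  moreover have "0 \<notin> ?P" "1 \<notin> ?P" using one_in_ends_X ends_Y by simp_all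
  ultimately have "Min ?P \<noteq> 0" "Min ?P \<noteq> 1" by metis+
  then have "2 \<le> Min ?P" by linarith
  moreover have "Min ?P \<le> Max ?P" using \<open>finite ?P\<close> Min_P by (rule Max_ge)
  moreover have "ends Y = insert 0 {Min ?P..Max ?P}" using P zero_in_ends_Y by blast
  ultimately show thesis using that by blast
qed

lemma nesting_exists: "\<exists>i. nesting n (card X) i X Y"
proof -
  obtain l h where Y: "ends Y = insert 0 {l..h}" "2 \<le> l" "l \<le> h" by (rule ends_Y_interval)
  obtain b where "b \<in> ends X" "\<forall>a\<in>ends Y. a < b" using last_end_in_X by blast
  then have "h < b" "b < 2 * n" using Y ends_X_subset by auto
  have cards: "2 * card X = card (ends X)" "2 * card Y = card (ends Y)"
    using card_matching[OF matching_X] card_matching[OF matching_Y] ends_X_subset ends_Y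
    by (simp_all add: finite_subset)
  have "card (ends Y) = 2 * n - card (ends X)"
    using ends_Y ends_X_subset by (simp add: card_Diff_subset finite_subset)
  moreover have "card (ends X) > 0"
    using one_in_ends_X ends_X_subset finite_subset by (fastforce simp: card_gt_0_iff)
  moreover have "card (ends Y) = h - l + 2" using Y by simp
  ultimately have k: "card X \<in> {1..<n}" and h: "h + 1 = (l - 1) + 2 * (n - card X)"
    using cards Y(2,3) by auto
  have i: "l - 1 \<in> {1..2 * card X - 1}" using Y(2) h \<open>h < b\<close> \<open>b < 2 * n\<close> k by auto
  have inner: "ends Y = inner_points n (card X) (l - 1)"
    unfolding Y(1) inner_points_def using h Y(2) by auto
  have "ends X = {0..<2 * n} - ends Y" using ends_Y ends_X_subset by blast
  then have "ends X = outer_points n (card X) (l - 1)"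
    using outer_inner_disjoint[OF k i] outer_inner_Un[OF k i] inner by blast
  then have "nesting n (card X) (l - 1) X Y"
    using k i inner matching_X matching_Y connected_X connected_Y
    by unfold_locales (simp_all add: connected_matchings_def)
  then show ?thesis by blast
qed

end

lemma root_component_exists:
  assumes n: "n \<ge> 2" and C: "C \<in> connected_matchings {0..<2 * n}"
  shows "\<exists>X r c. root_component n C X r c"
proof -
  have matching: "matching {0..<2 * n} C" and connected: "crossing_connected C"
    using C by (simp_all add: connected_matchings_def)
  have "0 \<in> ends C" "1 \<in> ends C" using matching_ends[OF matching] n by auto
  then obtain r c where r: "r \<in> C" "0 = fst r \<or> 0 = snd r" and c: "c \<in> C" "1 = fst c \<or> 1 = snd c"
    by (blast elim: in_endsE)
  have "fst r = 0" using r matching_less[OF matching r(1)] by auto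
  have "snd r \<noteq> 1"
  proof
    assume "snd r = 1"
    have "card C = n" using card_matching[OF matching] by simp
    then have "{r} \<noteq> C" using n by auto
    then obtain q where "crosses r q"
      using crossing_connectedE[OF connected, of "{r}"] r(1) by blast
    then show False using \<open>fst r = 0\<close> \<open>snd r = 1\<close> by (auto simp: crosses_def)
  qed
  then have "c \<noteq> r" using c \<open>fst r = 0\<close> by auto
  then have "fst c = 1"
    using c matching_less[OF matching c(1)] matching_disjoint[OF matching c(1) r(1)] \<open>fst r = 0\<close>
    by auto
  obtain X where "c \<in> X" "X \<subseteq> C - {r}" "crossing_connected X"
    "\<And>p q. p \<in> X \<Longrightarrow> q \<in> C - {r} - X \<Longrightarrow> \<not> crosses p q"
    using crossing_component[of c "C - {r}"] c(1) \<open>c \<noteq> r\<close> by blast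
  then have "root_component n C X r c"
    using C r(1) \<open>fst r = 0\<close> \<open>fst c = 1\<close> by unfold_locales auto
  then show ?thesis by blast
qed

lemma bij_betw_nesting:
  assumes "n \<ge> 2"
  shows "bij_betw (\<lambda>(k, i, X, Y). X \<union> Y) {(k, i, X, Y). nesting n k i X Y}
    (connected_chord_diagrams n)"
  unfolding connected_chord_diagrams_eq
proof (rule bij_betw_imageI)
  show "inj_on (\<lambda>(k, i, X, Y). X \<union> Y) {(k, i, X, Y). nesting n k i X Y}"
  proof (rule inj_onI)
    fix d d'
    assume dd': "d \<in> {(k, i, X, Y). nesting n k i X Y}" "d' \<in> {(k, i, X, Y). nesting n k i X Y}"
      "(\<lambda>(k, i, X, Y). X \<union> Y) d = (\<lambda>(k, i, X, Y). X \<union> Y) d'"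
    obtain k i X Y k' i' X' Y' where "d = (k, i, X, Y)" "d' = (k', i', X', Y')"
      by (cases d; cases d')
    then show "d = d'" using dd' nesting_unique[of n k i X Y k' i' X' Y'] by simp
  qed
  show "(\<lambda>(k, i, X, Y). X \<union> Y) ` {(k, i, X, Y). nesting n k i X Y} =
    connected_matchings {0..<2 * n}"
  proof (intro equalityI subsetI)
    fix C assume "C \<in> (\<lambda>(k, i, X, Y). X \<union> Y) ` {(k, i, X, Y). nesting n k i X Y}"
    then show "C \<in> connected_matchings {0..<2 * n}" using nesting.Un_in_connected_matchings by auto
  next
    fix C assume "C \<in> connected_matchings {0..<2 * n}"
    then obtain X r c where "root_component n C X r c"
      using root_component_exists[OF assms] by blast
    then interpret root_component n C X r c .
    obtain i where "nesting n (card X) i X Y" using nesting_exists by blast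
    moreover have "C = X \<union> Y" using X_subset by (auto simp: Y_def)
    ultimately show "C \<in> (\<lambda>(k, i, X, Y). X \<union> Y) ` {(k, i, X, Y). nesting n k i X Y}"
      by (intro image_eqI[of _ _ "(card X, i, X, Y)"]) simp_all
  qed
qed

lemma card_connected_chord_diagrams_rec:
  assumes "n \<ge> 2"
  shows "card (connected_chord_diagrams n) = (\<Sum>k\<in>{1..<n}. (2 * k - 1) *
    card (connected_chord_diagrams k) * card (connected_chord_diagrams (n - k)))"
proof -
  let ?c = "\<lambda>k. card (connected_chord_diagrams k)"
  let ?pairs = "\<lambda>k i.
    connected_matchings (outer_points n k i) \<times> connected_matchings (inner_points n k i)"
  have finite_pairs: "finite (?pairs k i)" for k i by (simp add: finite_connected_matchings)
  have "{(k, i, X, Y). nesting n k i X Y} = (SIGMA k:{1..<n}. SIGMA i:{1..2 * k - 1}. ?pairs k i)"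
    by (auto simp: nesting_def)
  then have "?c n = card (SIGMA k:{1..<n}. SIGMA i:{1..2 * k - 1}. ?pairs k i)"
    using bij_betw_same_card[OF bij_betw_nesting[OF assms]] by simp
  also have "\<dots> = (\<Sum>k\<in>{1..<n}. card (SIGMA i:{1..2 * k - 1}. ?pairs k i))"
    by (intro card_SigmaI ballI finite_SigmaI finite_pairs) simp_all
  also have "\<dots> = (\<Sum>k\<in>{1..<n}. \<Sum>i\<in>{1..2 * k - 1}. card (?pairs k i))"
    by (intro sum.cong refl card_SigmaI ballI finite_pairs) simp
  also have "\<dots> = (\<Sum>k\<in>{1..<n}. \<Sum>i\<in>{1..2 * k - 1}. ?c k * ?c (n - k))"
    by (intro sum.cong refl)
       (simp add: card_cartesian_product card_connected_matchings card_outer_points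
         card_inner_points)
  finally show ?thesis by (simp add: mult.assoc)
qed

section \<open>Comparison\<close>

theorem theorem1p10:
  fixes n :: nat
  assumes "n \<ge> 1"
  shows "num_bridgeless_maps n = card (connected_chord_diagrams n)"
  using assms
proof (induction n rule: less_induct)
  case (less n)
  consider "n = 1" | "n \<ge> 2" using less.prems by linarith
  then show ?case
  proof cases
    case 1
    then show ?thesis using num_bridgeless_maps_1 card_connected_chord_diagrams_1 by simp
  next
    case 2
    show ?thesis
      unfolding num_bridgeless_maps_rec[OF 2] card_connected_chord_diagrams_rec[OF 2]
    proof (rule sum.cong)
      fix k assume "k \<in> {1..<n}"
      then have "1 \<le> k" "k < n" "1 \<le> n - k" "n - k < n" by auto
      then show "(2 * k - 1) * num_bridgeless_maps k * num_bridgeless_maps (n - k) =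
          (2 * k - 1) * card (connected_chord_diagrams k) * card (connected_chord_diagrams (n - k))"
        by (simp add: less.IH)
    qed simp
  qed
qed

end
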